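(* Let $n\ge1$ be an integer and let $l\in[0,2n]$. The inverse reduction map $$\mathrm{red}^{-1}_l:\ \bigsqcup_{\substack{0\le t\le \min\{l,2n-l\}\\ l-t\in 2\mathbb Z}} SpT_{2n}(\varpi_t)\longrightarrow SST_{2n}(\varpi_l),\qquad \mathbf b=(b_1,\dots,b_{t-1},b_t)\mapsto \mathrm{red}_l^{-1}(\mathbf b)=\mathbf a,$$ is such that the following hold. (1) For $l=0,1$, either $t=0$ or respectively $t=1$, in which cases $\mathrm{red}_l^{-1}=\mathrm{id}$, where $SpT_{2n}(\varpi_0)=SST_{2n}(\varpi_0)=\{()\}$ and $SpT_{2n}(\varpi_1)=SST_{2n}(\varpi_1)$. (2) For $l=2$, either $t=0$, in which case $\mathbf b=()$ and $\mathrm{red}_2^{-1}(())=(1,2)$; or $t=2$, in which case $\mathbf b=(b_1,b_2)\in SpT_{2n}(\varpi_2)=SST_{2n}(\varpi_2)\setminus\{(1,2)\}$ and $\mathrm{red}_2^{-1}(\mathbf b)=\mathbf b$. (3) Let $l\ge3$. If $t=0$ and $l\in2\mathbb Z$, then $\mathbf b=()$ and $\mathbf a=(1,2,\dots,l)$. If $t=1$ and $l\notin2\mathbb Z$, then $\mathbf b=(b)\in SpT_{2n}(\varpi_1)$ and, putting $\hat{\mathbf a}:=[1,l-1]=\mathrm{red}_{l-1}^{-1}(())$, $$\mathbf a=\begin{cases}\hat{\mathbf a}\sqcup\{b\}, & \text{if } \hat{\mathbf a}\subseteq[1,b-1],\\ (\hat{\mathbf a}\setminus\{b+1\})\sqcup[l,l+1],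 & \text{if } b\notin2\mathbb Z\text{ and } b\in\hat{\mathbf a},\\ (\hat{\mathbf a}\setminus\{b-1\})\sqcup[l,l+1], & \text{if } b\in2\mathbb Z\text{ and } b\in\hat{\mathbf a}.\end{cases}$$ (4) Let $l\ge3$ and $t\ge2$. (4a) Suppose $\mathbf b\in SpT_{2n}(\varpi_t)$ does not have as a suffix a nonempty interval fixed by the parity involution $\mathbf s$. Define $\hat{\mathbf a}:=\mathrm{red}_{l-1}^{-1}(b_1,\dots,b_{t-1})\in SST_{2n}(\varpi_{l-1})$. Then $$\hat{\mathbf a}=\begin{cases}(\hat{\mathbf a}\cap[1,b_{t-1}-1])\sqcup\{b_{t-1}\}\sqcup[b_{t-1}+1,b_{t-1}+s], & \text{if } b_{t-1}\in2\mathbb Z,\\ (\hat{\mathbf a}\cap[1,b_{t-1}-1])\sqcup\{b_{t-1}\}\sqcup[b_{t-1}+2,b_{t-1}+1+s], & \text{if } b_{t-1}\notin2\mathbb Z,\end{cases}$$ where $0\le s\in2\mathbb Z$ is such that $s+|\hat{\mathbf a}\cap[1,b_{t-1}]|=l-1$, and, with this $s$, $$\mathbf a=\begin{cases}\hat{\mathbf a}\sqcup\{b_t\}, & \text{if } \hat{\mathbf a}\subseteq[1,b_t-1],\ b_t\notin2\mathbb Z,\\ (\hat{\mathbf a}\setminus\{\mathbf s(b_t)\})\sqcup[b_{t-1}+1+s,\,b_{t-1}+2+s], & \text{if } b_t\in\hat{\mathbf a},\ b_{t-1}\in2\mathbb Z,\ b_t\notin2\mathbb Z,\\ (\hat{\mathbf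 a}\setminus\{\mathbf s(b_t)\})\sqcup[b_{t-1}+2+s,\,b_{t-1}+3+s], & \text{if } b_t\in\hat{\mathbf a},\ b_{t-1}\notin2\mathbb Z,\ b_t\notin2\mathbb Z,\\ \hat{\mathbf a}\sqcup\{b_t\}, & \text{if } \hat{\mathbf a}\subseteq[1,b_t-2],\ b_{t-1}<b_t-1,\ b_t\in2\mathbb Z,\\ (\hat{\mathbf a}\setminus\{\mathbf s(b_t)\})\sqcup[b_{t-1}+s+1,\,b_{t-1}+s+2], & \text{if } \mathbf s(b_t)\in\hat{\mathbf a},\ b_{t-1}<b_t-1,\ b_{t-1}\in2\mathbb Z,\ b_t\in2\mathbb Z,\\ (\hat{\mathbf a}\setminus\{\mathbf s(b_t)\})\sqcup[b_{t-1}+s+2,\,b_{t-1}+s+3], & \text{if } \mathbf s(b_t)\in\hat{\mathbf a},\ b_{t-1}<b_t-1,\ b_{t-1}\notin2\mathbb Z,\ b_t\in2\mathbb Z.\end{cases}$$ (4b) Otherwise, $\mathbf b=(b_1,\dots,b_{t-r-1})\sqcup[b_t-r,b_t]\in SpT_{2n}(\varpi_t)$ for some $1\le r<t$, with $b_t\in2\mathbb Z$ and $b_{t-r-1}<b_t-r-1<b_{t-r}=b_t-r$ (where $b_0:=0$). Then $$(\mathbf b\setminus\{b_t,\mathbf s(b_t)\})\sqcup\{b_t-r-1\}=(b_1,\dots,b_{t-r-1})\sqcup[b_t-r-1,b_t-2]\in SpT_{2n}(\varpi_{t-1}).$$ Define $\overline{\mathbf a}:=\mathrm{red}_{l-1}^{-1}\big((b_1,\dots,b_{t-r-1})\sqcup[b_t-r-1,b_t-2]\big)\in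 SST_{2n}(\varpi_{l-1})$. Then $$\overline{\mathbf a}=(\overline{\mathbf a}\cap[1,b_t-r-2])\sqcup[b_t-r-1,\,b_t-2+s]$$ for some $0\le s\in2\mathbb Z$ such that $|\overline{\mathbf a}\cap[1,b_t-r-2]|+r+s=l-1$, and, with this $s$, $$\mathbf a=(\overline{\mathbf a}\setminus\{b_t-r-1\})\sqcup[b_t-2+s+1,\,b_t-2+s+2].$$
   Context: For integers $a,b$, $[a,b]=\{x\in\mathbb Z: a\le x\le b\}$ (empty if $a>b$). For $k\in[0,2n]$, $\varpi_k=(1,\dots,1)$ ($k$ ones), and $SST_{2n}(\varpi_k)$ is the set of columns of length $k$ on the alphabet $[1,2n]$, i.e. strictly increasing sequences $(a_1<\dots<a_k)$ with entries in $[1,2n]$. Columns are identified with $k$-element subsets of $[1,2n]$, and set operations ($\cap$, $\setminus$, and disjoint union $\sqcup$) on columns are understood through this identification; for $k=0$ the only column is the empty column $()$. A column $(a_1,\dots,a_k)$ is symplectic if $a_i\ge 2i-1$ for all $i\in[1,k]$; $SpT_{2n}(\varpi_k)\subseteq SST_{2n}(\varpi_k)$ is the set of symplectic columns of length $k$. The parity involution $\mathbf s:\mathbb Z\to\mathbb Z$ is $\mathbf s(x)=x+1$ if $x$ is odd and $\mathbf s(x)=x-1$ if $x$ is even. A column $\mathbf b=(b_1,\dots,b_t)$ has a nonempty interval fixed by $\mathbf s$ as a suffix if some suffix $(b_j,\dots,b_t)$, $1\le j\le t$, consists of consecutive integers and satisfies $\mathbf s(\{b_j,\dots,b_t\})=\{b_j,\dots,b_t\}$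 (equivalently, $t\ge2$, $b_t$ is even and $b_{t-1}=b_t-1$). For a column $\mathbf a=(a_1,\dots,a_l)$ the set of removal entries $\mathrm{rem}(\mathbf a)\subseteq\mathbf a$ is defined recursively: - $\mathrm{rem}(\mathbf a)=\emptyset$ if $l\le 1$; - $\mathrm{rem}(\mathbf a)=\mathrm{rem}(a_1,\dots,a_{l-2})\sqcup\{a_{l-1},a_l\}$ if $l\ge2$, $a_l$ is even, $a_{l-1}=a_l-1$ and $a_l<2l-|\mathrm{rem}(a_1,\dots,a_{l-2})|-1$; - $\mathrm{rem}(\mathbf a)=\mathrm{rem}(a_1,\dots,a_{l-1})$ otherwise. The reduction of $\mathbf a$ is $\mathrm{red}(\mathbf a)=\mathbf a\setminus\mathrm{rem}(\mathbf a)$. For each $l\in[0,2n]$ the reduction map $$\mathrm{red}_l: SST_{2n}(\varpi_l)\to\bigsqcup_{\substack{0\le t\le \min\{l,2n-l\}\\ l-t\in 2\mathbb Z}} SpT_{2n}(\varpi_t),\quad \mathbf a\mapsto\mathrm{red}(\mathbf a),$$ is a bijection, and $\mathrm{red}_l^{-1}$ denotes its inverse. *)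

theory Defs
  imports Main "HOL-Library.FuncSet" "HOL-Library.Sublist"
begin

(* Columns are strictly increasing lists of integers; the identification of a column
   with a set of entries is the function set. *)

definition SST :: "nat \<Rightarrow> nat \<Rightarrow> int list set" where
  "SST n k = {a. length a = k \<and> sorted_wrt (<) a \<and> set a \<subseteq> {1..2 * int n}}"

(* 1-based entries, with the convention that the entry of index 0 is 0. *)
definition entry :: "int list \<Rightarrow> nat \<Rightarrow> int" where
  "entry a i = (if i = 0 then 0 else a ! (i - 1))"

definition symplectic :: "int list \<Rightarrow> bool" where
  "symplectic a \<longleftrightarrow> (\<forall>i\<in>{1..length a}. entry a i \<ge> 2 * int i - 1)"

definition SpT :: "nat \<Rightarrow> nat \<Rightarrow> int list set" where
  "SpT n k = {a \<in> SST n k. symplectic a}"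

definition parity_inv :: "int \<Rightarrow> int" where
  "parity_inv x = (if odd x then x + 1 else x - 1)"

definition has_fixed_interval_suffix :: "int list \<Rightarrow> bool" where
  "has_fixed_interval_suffix b \<longleftrightarrow>
     (\<exists>c. suffix c b \<and> c \<noteq> [] \<and> (\<exists>x y. c = [x..y]) \<and> parity_inv ` set c = set c)"

function removal :: "int list \<Rightarrow> int set" where
  "removal a =
     (let l = length a in
      if l \<le> 1 then {}
      else if even (entry a l) \<and> entry a (l - 1) = entry a l - 1 \<and>
              entry a l < 2 * int l - int (card (removal (take (l - 2) a))) - 1
      then removal (take (l - 2) a) \<union> {entry a (l - 1), entry a l}
      else removal (take (l - 1) a))"
  by pat_completeness auto
termination by (relation "measure length") auto

declare removal.simps [simp del]

definition reduction :: "int list \<Rightarrow> int list" where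
  "reduction a = filter (\<lambda>x. x \<notin> removal a) a"

(* For l \<le> 2 n both natural-number subtractions are exact. *)
definition red_lengths :: "nat \<Rightarrow> nat \<Rightarrow> nat set" where
  "red_lengths n l = {t. t \<le> min l (2 * n - l) \<and> even (l - t)}"

definition red_target :: "nat \<Rightarrow> nat \<Rightarrow> int list set" where
  "red_target n l = (\<Union>t\<in>red_lengths n l. SpT n t)"

definition red_inv :: "nat \<Rightarrow> nat \<Rightarrow> int list \<Rightarrow> int list" where
  "red_inv n l = the_inv_into (SST n l) reduction"

(* X is the union of the sets in the list, and these are pairwise disjoint. *)
definition disj_union_of :: "int set \<Rightarrow> int set list \<Rightarrow> bool" where
  "disj_union_of X Xs \<longleftrightarrow> X = \<Union>(set Xs) \<and> sorted_wrt disjnt Xs"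

(* A definition by cases, given as a list of pairs (condition, assertion): at least one of
   the conditions holds, and the assertion holds in every case whose condition is met. *)
definition by_cases :: "(bool \<times> bool) list \<Rightarrow> bool" where
  "by_cases cs \<longleftrightarrow> list_ex fst cs \<and> list_all (\<lambda>(P, Q). P \<longrightarrow> Q) cs"

end

theory Submission
  imports Defs
begin

text \<open>
Split the alphabet into the pairs \<open>{2 * k - 1, 2 * k}\<close>, which are the orbits of the parity involution, and
read a column as a word in these pairs from bottom to top. An empty pair is an opening bracket, a full
pair is a closing bracket, and a pair with one entry is neutral. The removal entries form exactly the
closing brackets without a partner (\<open>removal_eq_pairs_surplus\<close>), so the reduction turns the unmatched
closing brackets into opening ones, and it leaves a word in which every closing bracket is matched.

In the reduced word the removed pairs are the first unmatched opening brackets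
(\<open>surplus_eq_free_pairs\<close>). Hence a column is recovered from its reduction and its length, and the
inverse map turns the first \<open>(l - t) div 2\<close> unmatched opening brackets into closing ones, that is, it
fills the first \<open>(l - t) div 2\<close> unmatched empty pairs (\<open>red_inv_SpT\<close>). Since \<open>l - t\<close> does not change when
\<open>l\<close> and \<open>t\<close> both drop by one, each claim compares the unmatched empty pairs of two sets.

If the pair of the last entry \<open>q\<close> contains no other entry, then dropping \<open>q\<close> makes this pair empty and
unmatched, like all pairs above the second last entry. Either it is not reached by the filling, and
\<open>q\<close> is simply added; or it is, and then the pair keeps only \<open>q\<close> and the next pair is filled instead
(\<open>free_pairs_insert_greatest\<close>, \<open>red_inv_append_last\<close>). If \<open>q\<close> ends a full pair, then dropping \<open>q\<close> would
release an opening bracket further down. Moving the whole final run of consecutive letters down by one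
place, and dropping one letter, avoids this: the matching below the run is the same before and after
(\<open>free_pairs_shift_run\<close>, \<open>red_inv_interval\<close>).
\<close>

section \<open>Pairs of letters and their balance\<close>

definition pair :: "nat \<Rightarrow> int set" where
  "pair k = {2 * int k - 1, 2 * int k}"

definition pairs :: "nat set \<Rightarrow> int set" where
  "pairs A = (\<Union>k\<in>A. pair k)"

text \<open>Reading the pairs upwards, \<open>excess\<close> is the height of the bracket word, an empty pair being an
opening and a full pair a closing bracket. At height \<open>0\<close> a closing bracket has no partner; the
truncated subtraction ignores it, and the full pairs ignored in this way are the surplus.\<close>
primrec excess :: "int set \<Rightarrow> nat \<Rightarrow> nat" where
  "excess X 0 = 0"
| "excess X (Suc k) =
     (if pair (Suc k) \<inter> X = {} then Suc (excess X k)
      else if pair (Suc k) \<subseteq> X then excess X k - 1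
      else excess X k)"

definition surplus :: "int set \<Rightarrow> nat set" where
  "surplus X = {k. 0 < k \<and> pair k \<subseteq> X \<and> excess X (k - 1) = 0}"

definition core :: "int set \<Rightarrow> int set" where
  "core X = X - pairs (surplus X)"

text \<open>With \<open>E\<close>, \<open>F\<close> and \<open>S\<close> the numbers of empty, full and half-filled pairs among the first \<open>k\<close>, one has
\<open>k = E + F + S\<close> and \<open>card (Y \<inter> {1..2 * int k}) = 2 * F + S\<close>, so this is \<open>E - F\<close>: the height without
truncation.\<close>
definition balance :: "int set \<Rightarrow> nat \<Rightarrow> int" where
  "balance Y k = int k - int (card (Y \<inter> {1..2 * int k}))"

text \<open>The height never returns below its value at \<open>k\<close>, so these are empty pairs whose opening bracket is
not closed later. If the balance is nowhere negative, it numbers these pairs consecutively from \<open>1\<close>,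
and \<open>balance Y k \<le> int m\<close> selects the first \<open>m\<close> of them.\<close>
definition free_pairs :: "nat \<Rightarrow> int set \<Rightarrow> nat set" where
  "free_pairs m Y =
     {k. 0 < k \<and> pair k \<inter> Y = {} \<and> balance Y k \<le> int m \<and> (\<forall>j\<ge>k. balance Y k \<le> balance Y j)}"

lemma in_pairs_iff: "x \<in> pairs A \<longleftrightarrow> (\<exists>k\<in>A. x = 2 * int k - 1 \<or> x = 2 * int k)"
  by (auto simp: pairs_def pair_def)

lemma pair_disjoint:
  assumes "j \<noteq> k"
  shows "pair j \<inter> pair k = {}"
proof -
  have "2 * int j \<noteq> 2 * int k - 1" "2 * int k \<noteq> 2 * int j - 1" by presburger+
  with assms show ?thesis by (auto simp: pair_def)
qed

lemma pair_nonempty: "pair k \<noteq> {}"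
  by (simp add: pair_def)

lemma pair_subset_pairs: "k \<in> A \<Longrightarrow> pair k \<subseteq> pairs A"
  by (auto simp: pairs_def)

lemma pair_meets_pairs_iff: "pair k \<inter> pairs A = {} \<longleftrightarrow> k \<notin> A"
proof -
  have "pair k \<inter> pairs A = (\<Union>j\<in>A. pair k \<inter> pair j)" by (auto simp: pairs_def)
  also have "\<dots> = {} \<longleftrightarrow> (\<forall>j\<in>A. j \<noteq> k)"
    using pair_disjoint pair_nonempty by (metis (no_types, lifting) SUP_bot_conv(2) inf.idem)
  finally show ?thesis by blast
qed

lemma pairs_insert: "pairs (insert k A) = pair k \<union> pairs A"
  by (simp add: pairs_def)

lemma finite_pairs: "finite A \<Longrightarrow> finite (pairs A)"
  by (simp add: pairs_def pair_def)

lemma card_pairs: "finite A \<Longrightarrow> card (pairs A) = 2 * card A"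
proof (induction A rule: finite_induct)
  case empty
  show ?case by (simp add: pairs_def)
next
  case (insert k A)
  have "pair k \<inter> pairs A = {}" using insert.hyps pair_meets_pairs_iff by blast
  moreover have "card (pair k) = 2" by (simp add: pair_def)
  moreover have "finite (pair k)" by (simp add: pair_def)
  ultimately show ?case
    using insert finite_pairs[of A] by (simp add: pairs_insert card_Un_disjoint)
qed

lemma pairs_atLeastAtMost: "pairs {Suc N..N + d} = {2 * int N + 1..2 * int N + 2 * int d}"
proof (intro set_eqI iffI)
  fix x assume x: "x \<in> {2 * int N + 1..2 * int N + 2 * int d}"
  define k where "k = nat ((x + 1) div 2)"
  have k: "int k = (x + 1) div 2" using x by (simp add: k_def)
  have "2 * int N + 1 \<le> x" "x \<le> 2 * int N + 2 * int d" using x by auto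
  with k have "int N + 1 \<le> int k" "int k \<le> int N + int d" by linarith+
  then have "k \<in> {Suc N..N + d}" by simp
  moreover have "x = 2 * int k - 1 \<or> x = 2 * int k" unfolding k by presburger
  ultimately show "x \<in> pairs {Suc N..N + d}" unfolding in_pairs_iff by blast
qed (auto simp: in_pairs_iff)

lemma balance_Suc: "balance Y (Suc k) = balance Y k + 1 - int (card (Y \<inter> pair (Suc k)))"
proof -
  have "Y \<inter> {1..2 * int (Suc k)} = (Y \<inter> {1..2 * int k}) \<union> (Y \<inter> pair (Suc k))"
    by (auto simp: pair_def)
  moreover have "(Y \<inter> {1..2 * int k}) \<inter> (Y \<inter> pair (Suc k)) = {}"
    by (auto simp: pair_def)
  moreover have "finite (pair (Suc k))" by (simp add: pair_def)
  ultimately show ?thesis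
    unfolding balance_def by (simp add: card_Un_disjoint)
qed

lemma balance_Suc_cases:
  "balance Y (Suc k) =
     (if pair (Suc k) \<inter> Y = {} then balance Y k + 1
      else if pair (Suc k) \<subseteq> Y then balance Y k - 1
      else balance Y k)"
proof -
  let ?x = "2 * int (Suc k) - 1" and ?y = "2 * int (Suc k)"
  have "card (Y \<inter> {?x, ?y}) = (if ?x \<in> Y then 1 else 0) + (if ?y \<in> Y then 1 else 0)"
    by (simp add: Int_insert_right)
  then show ?thesis
    unfolding balance_Suc by (auto simp: pair_def)
qed

lemma balance_0 [simp]: "balance Y 0 = 0"
  by (simp add: balance_def)

lemma surplus_upto_Suc:
  "surplus X \<inter> {..Suc k} = (if Suc k \<in> surplus X then insert (Suc k) (surplus X \<inter> {..k}) else surplus X \<inter> {..k})"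
  by (auto simp: le_Suc_eq)

text \<open>Each removed pair turns from full to empty. The truncated height stays at \<open>0\<close> there, whereas the
balance of the core goes up by one; at every other pair both change alike.\<close>
lemma balance_core: "balance (core X) k = int (excess X k) + int (card (surplus X \<inter> {..k}))"
proof (induction k)
  case 0
  show ?case by (simp add: surplus_def Collect_conj_eq)
next
  case (Suc k)
  have red: "pair (Suc k) \<inter> core X = (if Suc k \<in> surplus X then {} else pair (Suc k) \<inter> X)"
  proof (cases "Suc k \<in> surplus X")
    case True
    then show ?thesis using pair_subset_pairs unfolding core_def by auto
  next
    case False
    then have "pair (Suc k) \<inter> pairs (surplus X) = {}" by (simp add: pair_meets_pairs_iff)
    with False show ?thesis unfolding core_def by auto
  qed
  show ?case
  proof (cases "Suc k \<in> surplus X")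
    case True
    then have "pair (Suc k) \<subseteq> X" "excess X k = 0" by (auto simp: surplus_def)
    then show ?thesis
      using True Suc red by (auto simp: balance_Suc_cases surplus_upto_Suc pair_def)
  next
    case False
    have sub: "pair (Suc k) \<subseteq> core X \<longleftrightarrow> pair (Suc k) \<subseteq> X" using red False by auto
    have "pair (Suc k) \<subseteq> X \<Longrightarrow> excess X k > 0" using False by (auto simp: surplus_def)
    then show ?thesis
      using False Suc red by (auto simp: balance_Suc_cases surplus_upto_Suc sub)
  qed
qed

lemma finite_surplus: "finite X \<Longrightarrow> finite (surplus X)"
proof -
  assume "finite X"
  moreover have "surplus X \<subseteq> (\<lambda>x. nat (x div 2)) ` X"
    by (force simp: surplus_def pair_def)
  ultimately show ?thesis by (meson finite_imageI finite_subset)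
qed

lemma pairs_surplus_subset: "pairs (surplus X) \<subseteq> X"
  by (auto simp: pairs_def surplus_def)

lemma core_decomposition: "X = core X \<union> pairs (surplus X)"
  using pairs_surplus_subset[of X] by (auto simp: core_def)

lemma card_core:
  assumes "finite X"
  shows "card X = card (core X) + 2 * card (surplus X)"
proof -
  have fin: "finite (surplus X)" by (rule finite_surplus[OF assms])
  have "card X = card (core X \<union> pairs (surplus X))" by (subst core_decomposition) (rule refl)
  also have "\<dots> = card (core X) + card (pairs (surplus X))"
    using assms fin by (intro card_Un_disjoint) (auto simp: core_def finite_pairs)
  finally show ?thesis by (simp add: card_pairs fin)
qed

section \<open>The surplus is determined by the core\<close>

text \<open>A removed pair occurs at excess \<open>0\<close>, where the balance of the core equals the number of pairs removed
so far, and this number never decreases later. Conversely, suppose a free pair \<open>k\<close> was not removed.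
It was empty from the start, so the excess is positive at \<open>k\<close>, and the bound on the balance forces a
later removal. Just before the first one the excess is \<open>0\<close>, so the balance has dropped below its value at \<open>k\<close>.\<close>
lemma surplus_eq_free_pairs:
  assumes "finite X"
  shows "surplus X = free_pairs (card (surplus X)) (core X)"
proof (intro set_eqI iffI)
  note fin = finite_surplus[OF assms]
  fix k assume k: "k \<in> surplus X"
  then obtain i where i: "k = Suc i" by (cases k) (auto simp: surplus_def)
  have "pair k \<inter> core X = {}"
    using pair_subset_pairs[OF k] by (auto simp: core_def)
  have "pair k \<noteq> {}" by (simp add: pair_def)
  then have "excess X k = 0" using k unfolding i by (auto simp: surplus_def)
  then have bal: "balance (core X) k = int (card (surplus X \<inter> {..k}))" by (simp add: balance_core)
  have "card (surplus X \<inter> {..k}) \<le> card (surplus X)" using fin by (simp add: card_mono)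
  moreover have "card (surplus X \<inter> {..k}) \<le> card (surplus X \<inter> {..j})" if "k \<le> j" for j
    using that fin by (intro card_mono) auto
  ultimately show "k \<in> free_pairs (card (surplus X)) (core X)"
    using \<open>pair k \<inter> core X = {}\<close> i bal by (force simp: free_pairs_def balance_core)
next
  note fin = finite_surplus[OF assms]
  fix k assume k: "k \<in> free_pairs (card (surplus X)) (core X)"
  show "k \<in> surplus X"
  proof (rule ccontr)
    assume nk: "k \<notin> surplus X"
    obtain i where i: "k = Suc i" using k by (cases k) (auto simp: free_pairs_def)
    have "pair k \<inter> X = {}"
      using k nk pair_meets_pairs_iff[of k "surplus X"] by (auto simp: free_pairs_def core_def)
    then have pos: "excess X k > 0" by (simp add: i)
    have "balance (core X) k \<le> int (card (surplus X))" using k by (simp add: free_pairs_def)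
    then have "card (surplus X \<inter> {..k}) < card (surplus X)" using pos by (simp add: balance_core)
    then have "\<exists>j. j \<in> surplus X \<and> k < j"
      by (metis Int_absorb2 atMost_iff less_irrefl not_le subsetI)
    then have "\<exists>j. (j \<in> surplus X \<and> k < j) \<and> (\<forall>j'<j. \<not> (j' \<in> surplus X \<and> k < j'))"
      by (rule exists_least_iff[THEN iffD1])
    then obtain j where j: "j \<in> surplus X" "k < j" and least: "\<And>j'. j' < j \<Longrightarrow> k < j' \<Longrightarrow> j' \<notin> surplus X"
      by blast
    have "excess X (j - 1) = 0" using j by (simp add: surplus_def)
    moreover have "surplus X \<inter> {..j - 1} = surplus X \<inter> {..k}"
    proof (intro set_eqI iffI)
      fix y assume "y \<in> surplus X \<inter> {..j - 1}"
      then show "y \<in> surplus X \<inter> {..k}" using least[of y] j by force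
    qed (use j in auto)
    ultimately have "balance (core X) (j - 1) < balance (core X) k"
      using pos by (simp add: balance_core)
    moreover have "balance (core X) k \<le> balance (core X) (j - 1)"
      using k j by (simp add: free_pairs_def)
    ultimately show False by simp
  qed
qed

lemma core_inject:
  assumes "finite X" "finite X'" "core X = core X'" "card X = card X'"
  shows "X = X'"
proof -
  have "card (surplus X) = card (surplus X')"
    using assms card_core[of X] card_core[of X'] by simp
  then have "surplus X = surplus X'"
    using surplus_eq_free_pairs assms by metis
  then show ?thesis using core_decomposition assms(3) by metis
qed

section \<open>Sets of nonnegative balance are cores\<close>

text \<open>Below the first removed pair nothing is removed, so excess and balance agree there and are \<open>0\<close>; the
full pair itself would take the balance to \<open>-1\<close>.\<close>
lemma surplus_empty_if_balance_nonneg: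
  assumes "\<And>k. balance Y k \<ge> 0"
  shows "surplus Y = {}"
proof (rule ccontr)
  assume "surplus Y \<noteq> {}"
  then have "\<exists>k. k \<in> surplus Y \<and> (\<forall>j<k. j \<notin> surplus Y)"
    using exists_least_iff[of "\<lambda>k. k \<in> surplus Y"] by blast
  then obtain k where k: "k \<in> surplus Y" and least: "\<And>j. j < k \<Longrightarrow> j \<notin> surplus Y" by blast
  obtain i where i: "k = Suc i" using k by (cases k) (auto simp: surplus_def)
  have full: "pair k \<subseteq> Y" and "excess Y i = 0" using k by (auto simp: surplus_def i)
  moreover have "surplus Y \<inter> {..i} = {}" using least by (auto simp: i)
  ultimately have "balance (core Y) i = 0" by (simp add: balance_core)
  moreover have "core Y \<inter> {1..2 * int i} = Y \<inter> {1..2 * int i}"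
  proof -
    have "x \<notin> pairs (surplus Y)" if "x \<le> 2 * int i" for x
    proof
      assume "x \<in> pairs (surplus Y)"
      then obtain j where "j \<in> surplus Y" "x \<ge> 2 * int j - 1" by (auto simp: in_pairs_iff)
      moreover from this have "k \<le> j" using least by (meson not_le)
      ultimately show False using that i by simp
    qed
    then show ?thesis by (auto simp: core_def)
  qed
  ultimately have "balance Y i = 0" by (simp add: balance_def)
  then have "balance Y k = -1"
    using full by (auto simp: i balance_Suc_cases pair_def)
  then show False using assms[of k] by simp
qed

text \<open>Filling the pair above the last zero of the excess keeps the excess at \<open>0\<close> for one more step and
lowers every later, positive, value by one. This changes no decision about later pairs, so the filled
pair is the only new surplus.\<close>
lemma excess_fill_last_zero:
  assumes zero: "excess X i = 0" and pos: "\<And>j. i < j \<Longrightarrow> excess X j > 0"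
  shows "pair (Suc i) \<inter> X = {}"
    and "excess (X \<union> pair (Suc i)) j = (if j \<le> i then excess X j else excess X j - 1)"
proof -
  show emp: "pair (Suc i) \<inter> X = {}"
    using zero pos[of "Suc i"] by (auto split: if_splits)
  show "excess (X \<union> pair (Suc i)) j = (if j \<le> i then excess X j else excess X j - 1)"
  proof (induction j)
    case 0
    show ?case by simp
  next
    case (Suc j)
    show ?case
    proof (cases "j = i")
      case True
      then show ?thesis using Suc zero emp by (auto simp: pair_def)
    next
      case False
      then have "pair (Suc j) \<inter> pair (Suc i) = {}" by (simp add: pair_disjoint)
      then have "pair (Suc j) \<inter> (X \<union> pair (Suc i)) = {} \<longleftrightarrow> pair (Suc j) \<inter> X = {}"
        "pair (Suc j) \<subseteq> X \<union> pair (Suc i) \<longleftrightarrow> pair (Suc j) \<subseteq> X" by blast+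
      then show ?thesis using Suc False pos[of j] by auto
    qed
  qed
qed

lemma surplus_fill_last_zero:
  assumes zero: "excess X i = 0" and pos: "\<And>j. i < j \<Longrightarrow> excess X j > 0"
  shows "surplus (X \<union> pair (Suc i)) = insert (Suc i) (surplus X)"
    and "core (X \<union> pair (Suc i)) = core X"
proof -
  note fill = excess_fill_last_zero[OF assms]
  have late: "k \<notin> surplus X" if "i < k - 1" for k using that pos[of "k - 1"] by (auto simp: surplus_def)
  have late': "excess (X \<union> pair (Suc i)) (k - 1) \<noteq> 0"
    if "i < k - 1" and "pair k \<subseteq> X" for k
  proof
    assume "excess (X \<union> pair (Suc i)) (k - 1) = 0"
    then have "excess X (k - 1) \<le> 1" using that by (simp add: fill)
    moreover have "excess X k = excess X (k - 1) - 1"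
      using that by (cases k) (auto simp: pair_def)
    moreover have "excess X k > 0" using pos[of k] that by simp
    ultimately show False by simp
  qed
  have mem: "pair k \<subseteq> X \<union> pair (Suc i) \<longleftrightarrow> pair k \<subseteq> X" if "k \<noteq> Suc i" for k
    using pair_disjoint[OF that] by blast
  show sur: "surplus (X \<union> pair (Suc i)) = insert (Suc i) (surplus X)"
  proof (intro set_eqI)
    fix k
    consider "k = Suc i" | "k \<noteq> Suc i" "k - 1 \<le> i" | "k \<noteq> Suc i" "i < k - 1" by linarith
    then show "k \<in> surplus (X \<union> pair (Suc i)) \<longleftrightarrow> k \<in> insert (Suc i) (surplus X)"
    proof cases
      case 1
      then show ?thesis using zero by (simp add: surplus_def fill)
    next
      case 2
      then show ?thesis by (simp add: surplus_def fill mem)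
    next
      case 3
      have "k \<notin> surplus (X \<union> pair (Suc i))"
        using late'[OF 3(2)] mem[OF 3(1)] unfolding surplus_def by blast
      then show ?thesis using late 3 by blast
    qed
  qed
  show "core (X \<union> pair (Suc i)) = core X"
    using fill(1) by (auto simp: core_def sur pairs_insert)
qed

text \<open>Surplus pairs are created one at a time above the last zero of the excess. The bound on \<open>m\<close> says that
the excess is still positive at \<open>n\<close>, so that this last zero lies below \<open>n\<close> and the new pair fits into
\<open>{1..2 * int n}\<close>.\<close>
lemma core_surj:
  assumes "Y \<subseteq> {1..2 * int n}" "\<And>k. balance Y k \<ge> 0" "card Y + m \<le> n"
  shows "\<exists>X \<subseteq> {1..2 * int n}. core X = Y \<and> card (surplus X) = m"
  using assms(3)
proof (induction m)
  case 0
  have "surplus Y = {}" using surplus_empty_if_balance_nonneg assms(2) .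
  then have "core Y = Y" "card (surplus Y) = 0" by (simp_all add: core_def pairs_def)
  then show ?case using assms(1) by (intro exI[of _ Y]) simp
next
  case (Suc m)
  then have "card Y + m \<le> n" by simp
  then obtain X where X: "X \<subseteq> {1..2 * int n}" "core X = Y" "card (surplus X) = m"
    using Suc.IH by blast
  have fin: "finite X" using X(1) finite_subset by blast
  have beyond: "excess X (n + j) = excess X n + j" for j
  proof (induction j)
    case (Suc j)
    have "pair (Suc (n + j)) \<inter> X = {}" using X(1) by (auto simp: pair_def)
    then show ?case using Suc by simp
  qed simp
  have "surplus X \<subseteq> {..n}"
  proof
    fix k assume "k \<in> surplus X"
    then have "2 * int k \<in> X" by (simp add: surplus_def pair_def)
    then have "2 * int k \<in> {1..2 * int n}" using X(1) by blast
    then show "k \<in> {..n}" by simp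
  qed
  then have "surplus X \<inter> {..n} = surplus X" by blast
  moreover have "Y \<inter> {1..2 * int n} = Y" using assms(1) by auto
  ultimately have "int n - int (card Y) = int (excess X n) + int m"
    using balance_core[of X n] X by (simp add: balance_def)
  then have posn: "excess X n > 0" using Suc.prems by simp
  have pos: "excess X j > 0" if "n \<le> j" for j
    using that beyond[of "j - n"] posn by simp
  \<comment> \<open>The last zero up to \<open>n\<close>; all later values are positive, also beyond \<open>n\<close>.\<close>
  define i where "i = Max {j. j \<le> n \<and> excess X j = 0}"
  have "0 \<in> {j. j \<le> n \<and> excess X j = 0}" by simp
  then have ne: "{j. j \<le> n \<and> excess X j = 0} \<noteq> {}" by blast
  have "i \<in> {j. j \<le> n \<and> excess X j = 0}" unfolding i_def using ne by (intro Max_in) auto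
  then have "i \<le> n" "excess X i = 0" by simp_all
  moreover from this have "i \<noteq> n" using posn by auto
  ultimately have i: "i < n" "excess X i = 0" by simp_all
  have after: "excess X j > 0" if "i < j" for j
  proof (rule ccontr)
    assume "\<not> 0 < excess X j"
    then have "j \<in> {j. j \<le> n \<and> excess X j = 0}" using pos[of j] by (cases "n \<le> j") auto
    then have "j \<le> i" unfolding i_def by (intro Max_ge) auto
    then show False using that by simp
  qed
  note fill = surplus_fill_last_zero[OF i(2) after] excess_fill_last_zero(1)[OF i(2) after]
  have "Suc i \<notin> surplus X" using fill(3) pair_nonempty by (auto simp: surplus_def)
  then have "card (surplus (X \<union> pair (Suc i))) = Suc m"
    using fill(1) X(3) finite_surplus[OF fin] by simp
  moreover have "X \<union> pair (Suc i) \<subseteq> {1..2 * int n}" using X(1) i(1) by (auto simp: pair_def)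
  ultimately show ?case using fill(2) X(2) by (intro exI[of _ "X \<union> pair (Suc i)"]) simp
qed

section \<open>The recursion for the removal entries\<close>

lemma excess_cong:
  assumes "X \<inter> {..2 * int k} = X' \<inter> {..2 * int k}"
  shows "excess X k = excess X' k"
proof -
  have "j \<le> k \<Longrightarrow> excess X j = excess X' j" for j
  proof (induction j)
    case (Suc j)
    have "pair (Suc j) \<subseteq> {..2 * int k}" using Suc.prems by (auto simp: pair_def)
    then have "pair (Suc j) \<inter> X = pair (Suc j) \<inter> X'" using assms by blast
    then have "pair (Suc j) \<inter> X = {} \<longleftrightarrow> pair (Suc j) \<inter> X' = {}"
      "pair (Suc j) \<subseteq> X \<longleftrightarrow> pair (Suc j) \<subseteq> X'" by blast+
    then show ?case using Suc by simp
  qed simp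
  then show ?thesis by simp
qed

text \<open>This identity turns the numerical test in the recursion for the removal entries into the condition
that the excess vanishes.\<close>
lemma excess_at_top:
  assumes "Y \<subseteq> {1..2 * int k}"
  shows "int (excess Y k) = int k - int (card Y) + int (card (surplus Y))"
proof -
  have fin: "finite Y" using assms finite_subset by blast
  have "surplus Y \<subseteq> {..k}"
  proof
    fix j assume "j \<in> surplus Y"
    then have "2 * int j \<in> {1..2 * int k}" using assms by (auto simp: surplus_def pair_def)
    then show "j \<in> {..k}" by simp
  qed
  then have "surplus Y \<inter> {..k} = surplus Y" by blast
  moreover have "core Y \<inter> {1..2 * int k} = core Y" using assms by (auto simp: core_def)
  ultimately show ?thesis
    using balance_core[of Y k] card_core[OF fin] by (simp add: balance_def)
qed

lemma surplus_insert_greatest: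
  assumes "\<And>y. y \<in> X \<Longrightarrow> y < x"
  shows "j \<in> surplus (insert x X) \<longleftrightarrow>
    j \<in> surplus X \<or> 0 < j \<and> x = 2 * int j \<and> x - 1 \<in> X \<and> excess X (j - 1) = 0"
proof (cases "0 < j \<and> pair j \<subseteq> insert x X")
  case True
  then have le: "2 * int j \<le> x" using assms by (force simp: pair_def)
  have "{..2 * int (j - 1)} \<inter> {x} = {}" using le True by auto
  then have ex: "excess (insert x X) (j - 1) = excess X (j - 1)"
    by (intro excess_cong) auto
  have "pair j \<subseteq> X \<or> x = 2 * int j" using True le by (auto simp: pair_def)
  moreover have "2 * int j \<notin> X" if "x = 2 * int j" using assms that by blast
  ultimately show ?thesis using True ex by (auto simp: surplus_def pair_def)
next
  case False
  then show ?thesis by (auto simp: surplus_def pair_def)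
qed

text \<open>The recursion inspects the two largest entries. If they form the pair \<open>k\<close>, then with \<open>c\<close> surplus pairs
among the other \<open>l - 2\<close> entries the test reads \<open>2 * k < 2 * l - 2 * c - 1\<close>, that is
\<open>k - l + 1 + c \<le> 0\<close>; the left-hand side is the excess below the pair \<open>k\<close>. Otherwise the largest entry
completes no pair and does not affect the surplus.\<close>
lemma removal_eq_pairs_surplus:
  assumes "sorted_wrt (<) a" "\<And>x. x \<in> set a \<Longrightarrow> x \<ge> 1"
  shows "removal a = pairs (surplus (set a))"
  using assms
proof (induction a rule: length_induct)
  case (1 a)
  show ?case
  proof (cases "length a \<le> 1")
    case True
    have "k \<notin> surplus (set a)" for k
    proof
      assume "k \<in> surplus (set a)"
      then have "pair k \<subseteq> set a" by (simp add: surplus_def)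
      then have "card (pair k) \<le> card (set a)" by (simp add: card_mono)
      then show False using True card_length[of a] by (simp add: pair_def)
    qed
    then show ?thesis using True by (auto simp: removal.simps pairs_def)
  next
    case False
    obtain a' y x where a: "a = a' @ [y, x]"
    proof (cases a rule: rev_cases)
      case (snoc c x)
      with False that show ?thesis by (cases c rule: rev_cases) auto
    qed (use False in simp)
    define l where "l = length a"
    have take: "take (l - 2) a = a'" "take (l - 1) a = a' @ [y]" by (simp_all add: a l_def)
    have entries: "entry a l = x" "entry a (l - 1) = y"
      by (simp_all add: a l_def entry_def nth_append)
    have srt: "sorted_wrt (<) a'" "sorted_wrt (<) (a' @ [y])" and yx: "y < x"
      and below: "\<And>z. z \<in> set a' \<Longrightarrow> z < y" and ge1: "\<And>z. z \<in> set a \<Longrightarrow> z \<ge> 1"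
      using 1 by (auto simp: a sorted_wrt_append)
    have IH: "removal a' = pairs (surplus (set a'))"
      "removal (a' @ [y]) = pairs (surplus (insert y (set a')))"
      using 1(1) srt ge1 by (auto simp: a)
    have top: "\<And>z. z \<in> insert y (set a') \<Longrightarrow> z < x" using below yx by force
    have ins: "j \<in> surplus (insert x (insert y (set a'))) \<longleftrightarrow> j \<in> surplus (insert y (set a')) \<or>
        0 < j \<and> x = 2 * int j \<and> x - 1 \<in> insert y (set a') \<and> excess (insert y (set a')) (j - 1) = 0"
      for j by (rule surplus_insert_greatest) (rule top)
    have seta: "set a = insert x (insert y (set a'))" by (auto simp: a)
    let ?c = "even x \<and> y = x - 1 \<and> x < 2 * int l - int (card (removal a')) - 1"
    have unfold: "removal a = (if ?c then removal a' \<union> {y, x} else removal (a' @ [y]))"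
      using False by (subst removal.simps) (simp add: Let_def l_def[symmetric] take[unfolded One_nat_def] entries[unfolded One_nat_def] insert_commute)
    show ?thesis
    proof (cases "even x \<and> y = x - 1")
      case True
      define k where "k = nat (x div 2)"
      have k: "x = 2 * int k" "0 < k" using True yx ge1[of y] by (auto simp: k_def a)
      have sub: "set a' \<subseteq> {1..2 * int (k - 1)}" using below ge1 True k by (force simp: a)
      have "card (set a') = l - 2"
        using srt(1) by (simp add: l_def a distinct_card strict_sorted_iff)
      then have ex: "int (excess (set a') (k - 1)) =
          int k - int l + 1 + int (card (surplus (set a')))"
        using excess_at_top[OF sub] k(2) False by (simp add: l_def)
      have "card (removal a') = 2 * card (surplus (set a'))"
        by (simp add: IH card_pairs finite_surplus)
      moreover have "2 * int k < 2 * int l - 2 * int (card (surplus (set a'))) - 1 \<longleftrightarrow>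
          excess (set a') (k - 1) = 0"
        using ex by linarith
      ultimately have c: "?c \<longleftrightarrow> excess (set a') (k - 1) = 0" using True k by simp
      have "{..2 * int (k - 1)} \<inter> {y} = {}" using k True by auto
      then have exy: "excess (insert y (set a')) (k - 1) = excess (set a') (k - 1)"
        by (intro excess_cong) auto
      have sy: "surplus (insert y (set a')) = surplus (set a')"
      proof -
        have "y \<noteq> 2 * int j" for j using True k by presburger
        then show ?thesis using surplus_insert_greatest[of "set a'" y, OF below] by blast
      qed
      have sx: "surplus (set a) = (if ?c then insert k (surplus (set a')) else surplus (set a'))"
      proof (intro set_eqI)
        fix j
        show "j \<in> surplus (set a) \<longleftrightarrow>
            j \<in> (if ?c then insert k (surplus (set a')) else surplus (set a'))"
        proof (cases "j = k")
          case jk: True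
          have "x - 1 \<in> insert y (set a')" using True by simp
          then show ?thesis
            unfolding c seta ins sy using k jk exy by simp
        next
          case jk: False
          then have "x \<noteq> 2 * int j" using k by simp
          then show ?thesis
            unfolding c seta ins sy using jk by simp
        qed
      qed
      show ?thesis
      proof (cases ?c)
        case c: True
        have "pair k = {y, x}" using True k by (simp add: pair_def)
        with c show ?thesis unfolding unfold sx IH by (simp add: pairs_insert Un_commute)
      next
        case c: False
        have "removal a = removal (a' @ [y])" using unfold unfolding if_not_P[OF c] .
        moreover have "surplus (set a) = surplus (set a')" using sx unfolding if_not_P[OF c] .
        ultimately show ?thesis by (simp add: IH sy)
      qed
    next
      case False
      then have "surplus (set a) = surplus (insert y (set a'))"
      proof (intro set_eqI)
        fix j
        have "x - 1 \<notin> insert y (set a')" if "x = 2 * int j"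
          using that False below yx by force
        then show "j \<in> surplus (set a) \<longleftrightarrow> j \<in> surplus (insert y (set a'))"
          unfolding seta ins by blast
      qed
      moreover have "\<not> ?c" using False by blast
      then have "removal a = removal (a' @ [y])" using unfold by (simp only: if_False)
      ultimately show ?thesis by (simp add: IH)
    qed
  qed
qed

section \<open>The inverse reduction map as a filling of free pairs\<close>

lemma SST_I:
  "sorted_wrt (<) a \<Longrightarrow> set a \<subseteq> {1..2 * int n} \<Longrightarrow> card (set a) = k \<Longrightarrow> a \<in> SST n k"
  by (auto simp: SST_def distinct_card strict_sorted_iff)

lemma SST_D:
  assumes "a \<in> SST n k"
  shows "sorted_wrt (<) a" "set a \<subseteq> {1..2 * int n}" "length a = k" "card (set a) = k"
  using assms by (auto simp: SST_def distinct_card strict_sorted_iff)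

lemma SpT_D:
  assumes "b \<in> SpT n k"
  shows "b \<in> SST n k" "symplectic b"
  using assms by (auto simp: SpT_def)

lemma reduction_SST:
  assumes "a \<in> SST n l"
  shows "set (reduction a) = core (set a)" "sorted_wrt (<) (reduction a)"
proof -
  have "removal a = pairs (surplus (set a))"
    using SST_D(1,2)[OF assms] by (intro removal_eq_pairs_surplus) auto
  then show "set (reduction a) = core (set a)" by (auto simp: reduction_def core_def)
  show "sorted_wrt (<) (reduction a)"
    using SST_D(1)[OF assms] by (simp add: reduction_def sorted_wrt_filter)
qed

lemma inj_on_reduction: "inj_on reduction (SST n l)"
proof (rule inj_onI)
  fix a a' assume a: "a \<in> SST n l" "a' \<in> SST n l" and eq: "reduction a = reduction a'"
  have "set a = set a'"
  proof (rule core_inject)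
    show "core (set a) = core (set a')"
      using reduction_SST(1)[OF a(1)] reduction_SST(1)[OF a(2)] eq by simp
    show "card (set a) = card (set a')" using SST_D(4)[OF a(1)] SST_D(4)[OF a(2)] by simp
  qed simp_all
  then show "a = a'" using strict_sorted_equal[OF SST_D(1)[OF a(1)] SST_D(1)[OF a(2)]] by simp
qed

text \<open>An entry that is at most \<open>2 * k\<close> has index at most \<open>k\<close> in a symplectic column, so at most \<open>k\<close> entries
are that small.\<close>
lemma symplectic_balance_nonneg:
  assumes "b \<in> SpT n t"
  shows "balance (set b) k \<ge> 0"
proof -
  have "set b \<inter> {1..2 * int k} \<subseteq> (!) b ` {..<k}"
  proof
    fix x assume x: "x \<in> set b \<inter> {1..2 * int k}"
    then obtain i where i: "i < length b" "x = b ! i" by (auto simp: in_set_conv_nth)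
    have "Suc i \<in> {1..length b}" using i by simp
    then have "entry b (Suc i) \<ge> 2 * int (Suc i) - 1"
      using SpT_D(2)[OF assms] unfolding symplectic_def by blast
    then show "x \<in> (!) b ` {..<k}" using x i by (simp add: entry_def)
  qed
  then have "card (set b \<inter> {1..2 * int k}) \<le> card ((!) b ` {..<k})" by (simp add: card_mono)
  also have "\<dots> \<le> k" using card_image_le[of "{..<k}" "(!) b"] by simp
  finally show ?thesis by (simp add: balance_def)
qed

text \<open>The closed form behind all the recursive descriptions: the inverse reduction adds the first
\<open>(l - t) div 2\<close> free pairs.\<close>
lemma red_inv_SpT:
  assumes "b \<in> SpT n t" "t \<in> red_lengths n l" "l \<le> 2 * n"
  shows "red_inv n l b \<in> SST n l"
    and "set (red_inv n l b) = set b \<union> pairs (free_pairs ((l - t) div 2) (set b))"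
proof -
  define m where "m = (l - t) div 2"
  have t: "t \<le> l" "t \<le> 2 * n - l" "even (l - t)" using assms(2) by (auto simp: red_lengths_def)
  have m: "l = t + 2 * m" using t by (auto simp: m_def)
  note b = SST_D[OF SpT_D(1)[OF assms(1)]]
  have le: "card (set b) + m \<le> n" using b(4) t m assms(3) by linarith
  obtain X where X: "X \<subseteq> {1..2 * int n}" "core X = set b" "card (surplus X) = m"
    using core_surj[OF b(2) symplectic_balance_nonneg[OF assms(1)], of m] le by blast
  have fin: "finite X" using X(1) finite_subset by blast
  define a where "a = sorted_list_of_set X"
  have seta: "set a = X" by (simp add: a_def fin)
  have a: "a \<in> SST n l"
    using card_core[OF fin] X m b(4) fin by (intro SST_I) (simp_all add: seta, simp add: a_def)
  have "reduction a = b"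
    using strict_sorted_equal[OF reduction_SST(2)[OF a] b(1)] reduction_SST(1)[OF a] X(2) seta
    by simp
  then have "red_inv n l b = a"
    unfolding red_inv_def using the_inv_into_f_f[OF inj_on_reduction a] by simp
  moreover have "X = set b \<union> pairs (free_pairs m (set b))"
    using core_decomposition[of X] surplus_eq_free_pairs[OF fin] X(2,3) by simp
  ultimately show "red_inv n l b \<in> SST n l"
    "set (red_inv n l b) = set b \<union> pairs (free_pairs ((l - t) div 2) (set b))"
    using a seta by (simp_all add: m_def)
qed

section \<open>Free pairs of a set and of its lower part\<close>

lemma balance_cong:
  "Y \<inter> {1..2 * int k} = Y' \<inter> {1..2 * int k} \<Longrightarrow> balance Y k = balance Y' k"
  by (simp add: balance_def)

lemma balance_mono:
  assumes "\<And>k. N < k \<Longrightarrow> \<not> pair k \<subseteq> Y" "N \<le> j" "j \<le> k"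
  shows "balance Y j \<le> balance Y k"
  using assms(3)
proof (induction k rule: dec_induct)
  case (step k)
  then have "\<not> pair (Suc k) \<subseteq> Y" using assms by simp
  then have "balance Y k \<le> balance Y (Suc k)" by (simp add: balance_Suc_cases)
  with step show ?case by linarith
qed simp

lemma balance_beyond:
  assumes "Y \<subseteq> {1..2 * int N}" "N \<le> k"
  shows "balance Y k = balance Y N + int k - int N"
proof -
  have "Y \<inter> {1..2 * int k} = Y" "Y \<inter> {1..2 * int N} = Y" using assms by auto
  then show ?thesis by (simp add: balance_def)
qed

text \<open>The free pairs below \<open>J\<close>, computed from the pairs below \<open>J\<close> and the least balance \<open>v\<close> attained from \<open>J\<close>
on. Two sets that agree below \<open>J\<close> and have the same \<open>v\<close> therefore have the same free pairs there.\<close>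
definition low_free_pairs :: "nat \<Rightarrow> int set \<Rightarrow> nat \<Rightarrow> int \<Rightarrow> nat set" where
  "low_free_pairs m Y J v =
     {k. 0 < k \<and> k < J \<and> pair k \<inter> Y = {} \<and> balance Y k \<le> int m \<and> balance Y k \<le> v \<and>
         (\<forall>j. k \<le> j \<and> j < J \<longrightarrow> balance Y k \<le> balance Y j)}"

lemma free_pairs_below:
  assumes "J \<le> N" "\<And>j. J \<le> j \<Longrightarrow> balance Y N \<le> balance Y j"
  shows "free_pairs m Y \<inter> {..<J} = low_free_pairs m Y J (balance Y N)"
proof (intro set_eqI iffI)
  fix k assume "k \<in> free_pairs m Y \<inter> {..<J}"
  then show "k \<in> low_free_pairs m Y J (balance Y N)"
    using assms(1) by (simp add: free_pairs_def low_free_pairs_def)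
next
  fix k assume k: "k \<in> low_free_pairs m Y J (balance Y N)"
  have "balance Y k \<le> balance Y j" if "k \<le> j" for j
  proof (cases "j < J")
    case True
    then show ?thesis using k that by (simp add: low_free_pairs_def)
  next
    case False
    then have "balance Y N \<le> balance Y j" using assms(2) by simp
    moreover have "balance Y k \<le> balance Y N" using k by (simp add: low_free_pairs_def)
    ultimately show ?thesis by simp
  qed
  then show "k \<in> free_pairs m Y \<inter> {..<J}"
    using k by (simp add: free_pairs_def low_free_pairs_def)
qed

lemma low_free_pairs_cong:
  assumes "Y \<inter> {..2 * int J - 2} = Y' \<inter> {..2 * int J - 2}"
  shows "low_free_pairs m Y J v = low_free_pairs m Y' J v"
proof -
  have bal: "balance Y j = balance Y' j" if "j < J" for j
  proof (rule balance_cong)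
    have "{1..2 * int j} \<subseteq> {..2 * int J - 2}" using that by auto
    then show "Y \<inter> {1..2 * int j} = Y' \<inter> {1..2 * int j}" using assms by blast
  qed
  have "pair j \<inter> Y = pair j \<inter> Y'" if "j < J" for j
  proof -
    have "pair j \<subseteq> {..2 * int J - 2}" using that by (auto simp: pair_def)
    then show ?thesis using assms by blast
  qed
  with bal show ?thesis unfolding low_free_pairs_def by (intro Collect_cong) auto
qed

lemma low_free_pairs_subset: "low_free_pairs m Y J v \<subseteq> {1..<J}"
  by (auto simp: low_free_pairs_def)

text \<open>Without full pairs above \<open>N\<close> the balance is nondecreasing there, so every empty pair is unmatched.\<close>
lemma free_pairs_above:
  assumes "\<And>k. N < k \<Longrightarrow> \<not> pair k \<subseteq> Y" "N < k"
  shows "k \<in> free_pairs m Y \<longleftrightarrow> pair k \<inter> Y = {} \<and> balance Y k \<le> int m"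
proof -
  have "balance Y k \<le> balance Y j" if "k \<le> j" for j
    using balance_mono[of N Y k j] assms that by simp
  then show ?thesis using assms(2) by (auto simp: free_pairs_def)
qed

lemma free_pairs_beyond:
  assumes "Y \<subseteq> {1..2 * int N}"
  shows "free_pairs m Y \<inter> {N<..} = {Suc N..N + nat (int m - balance Y N)}"
proof (intro set_eqI)
  fix k
  have emp: "pair k \<inter> Y = {}" if "N < k" for k using assms that by (force simp: pair_def)
  then have nf: "\<not> pair k \<subseteq> Y" if "N < k" for k using that pair_nonempty by blast
  show "k \<in> free_pairs m Y \<inter> {N<..} \<longleftrightarrow> k \<in> {Suc N..N + nat (int m - balance Y N)}"
  proof (cases "N < k")
    case True
    have "k \<in> free_pairs m Y \<longleftrightarrow> balance Y k \<le> int m"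
      using free_pairs_above[of N Y k m] nf True emp by simp
    also have "\<dots> \<longleftrightarrow> k \<le> N + nat (int m - balance Y N)"
      using balance_beyond[OF assms, of k] True by linarith
    finally show ?thesis using True by auto
  qed auto
qed

lemma nat_set_split: "(S :: nat set) = (S \<inter> {..<J}) \<union> (S \<inter> {J..N}) \<union> (S \<inter> {N<..})" if "J \<le> Suc N"
  using that by auto

text \<open>The pair \<open>J\<close> is that of the largest entry of \<open>Y\<close>, with \<open>J = 0\<close> if there is none. Above \<open>J\<close> all pairs
of \<open>Y\<close> are free up to the bound \<open>m\<close> on the balance. A new entry in the pair \<open>K\<close> makes that pair
half-filled: if it was free, the next pair above the block of free pairs replaces it, and otherwise
nothing changes. Below \<open>J\<close> nothing changes either, since in both
sets the least balance from \<open>J\<close> on is attained at \<open>J\<close>.\<close>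
lemma free_pairs_insert_greatest:
  assumes Y: "Y \<subseteq> {1..2 * int J}" and top: "J = 0 \<or> pair J \<inter> Y \<noteq> {}"
    and q: "q \<in> pair K" "J < K"
  obtains A d where "A \<subseteq> {1..<J}" "free_pairs m Y = A \<union> {Suc J..J + d}"
    "free_pairs m (insert q Y) =
       A \<union> (if K \<le> J + d then {Suc J..Suc (J + d)} - {K} else {Suc J..J + d})"
proof -
  define d where "d = nat (int m - balance Y J)"
  define A where "A = low_free_pairs m Y J (balance Y J)"
  let ?Y = "insert q Y"
  have qgt: "2 * int K - 1 \<le> q" "q \<le> 2 * int K" using q(1) by (auto simp: pair_def)
  have emp: "pair k \<inter> Y = {}" if "J < k" for k using Y that by (force simp: pair_def)
  have emp': "pair k \<inter> ?Y = {} \<longleftrightarrow> k \<noteq> K" if "J < k" for k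
    using emp[OF that] q(1) pair_disjoint[of k K] by blast
  have nf: "\<not> pair k \<subseteq> Y" if "J < k" for k using that pair_nonempty emp by blast
  have nf': "\<not> pair k \<subseteq> ?Y" if "J < k" for k
  proof
    assume "pair k \<subseteq> ?Y"
    then have "pair k \<subseteq> {q}" using emp[OF that] by blast
    then show False by (auto simp: pair_def)
  qed
  have balJ: "balance ?Y J = balance Y J"
    using qgt q(2) by (intro balance_cong) auto
  have notJ: "J \<notin> free_pairs m Z" if "Z = Y \<or> Z = ?Y" for Z
    using that top by (auto simp: free_pairs_def)
  have below: "free_pairs m Y \<inter> {..<J} = A"
    unfolding A_def using nf by (intro free_pairs_below balance_mono[of J]) auto
  have below': "free_pairs m ?Y \<inter> {..<J} = A"
  proof -
    have "free_pairs m ?Y \<inter> {..<J} = low_free_pairs m ?Y J (balance ?Y J)"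
      using nf' by (intro free_pairs_below balance_mono[of J]) auto
    also have "\<dots> = A"
      unfolding A_def balJ using qgt q(2) by (intro low_free_pairs_cong) auto
    finally show ?thesis .
  qed
  have above': "free_pairs m ?Y \<inter> {J<..} =
      (if K \<le> J + d then {Suc J..Suc (J + d)} - {K} else {Suc J..J + d})"
  proof (intro set_eqI)
    fix k
    show "k \<in> free_pairs m ?Y \<inter> {J<..} \<longleftrightarrow>
      k \<in> (if K \<le> J + d then {Suc J..Suc (J + d)} - {K} else {Suc J..J + d})"
    proof (cases "J < k \<and> k \<noteq> K")
      case True
      have "k \<in> free_pairs m ?Y \<longleftrightarrow> pair k \<inter> ?Y = {} \<and> balance ?Y k \<le> int m"
        by (rule free_pairs_above[of J]) (use nf' True in blast)+
      also have "\<dots> \<longleftrightarrow> balance ?Y k \<le> int m" using emp'[of k] True by blast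
      also have "balance ?Y k = balance Y J + int k - int J - (if K \<le> k then 1 else 0)"
      proof -
        have "finite Y" using Y finite_subset by blast
        moreover have "q \<notin> Y" using q emp[of K] by blast
        moreover have "Y \<inter> {1..2 * int k} = Y" "Y \<inter> {1..2 * int J} = Y" using Y True by auto
        moreover have "?Y \<inter> {1..2 * int k} = (if K \<le> k then ?Y else Y)"
        proof -
          have "q \<in> {1..2 * int k} \<longleftrightarrow> K \<le> k" using qgt q(2) True by auto
          then show ?thesis using \<open>Y \<inter> {1..2 * int k} = Y\<close> by auto
        qed
        ultimately show ?thesis by (simp add: balance_def)
      qed
      also have "\<dots> \<le> int m \<longleftrightarrow> k \<le> (if K \<le> J + d then Suc (J + d) else J + d)"
        using True q(2) unfolding d_def by (auto split: if_splits; linarith)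
      finally show ?thesis using True by auto
    next
      case False
      then show ?thesis using emp'[OF q(2)] q(2) by (auto simp: free_pairs_def)
    qed
  qed
  show thesis
  proof
    show "A \<subseteq> {1..<J}" unfolding A_def by (rule low_free_pairs_subset)
    show "free_pairs m Y = A \<union> {Suc J..J + d}"
      using nat_set_split[of J J "free_pairs m Y"] below free_pairs_beyond[OF Y, of m] notJ
      by (auto simp: d_def)
    show "free_pairs m ?Y =
        A \<union> (if K \<le> J + d then {Suc J..Suc (J + d)} - {K} else {Suc J..J + d})"
      using nat_set_split[of J J "free_pairs m ?Y"] below' above' notJ[of ?Y] by auto
  qed
qed

text \<open>Along the full pairs above \<open>J\<close> up to \<open>N\<close> the balance decreases, so it is least at \<open>N\<close> among all places
from \<open>J\<close> on, and no pair from \<open>J\<close> to \<open>N\<close> is free.\<close>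
lemma free_pairs_full_run:
  assumes Y: "Y \<subseteq> {1..2 * int N}" and run: "{2 * int J + 1..2 * int N} \<subseteq> Y"
    and JN: "J \<le> N" and last: "J = N \<Longrightarrow> pair J \<inter> Y \<noteq> {}"
  shows "free_pairs m Y =
    low_free_pairs m Y J (balance Y N) \<union> {Suc N..N + nat (int m - balance Y N)}"
proof -
  have inrun: "balance Y k = balance Y N + int N - int k" if "J \<le> k" "k \<le> N" for k
  proof -
    have "Y \<inter> {1..2 * int N} = (Y \<inter> {1..2 * int k}) \<union> {2 * int k + 1..2 * int N}"
    proof -
      have "{2 * int k + 1..2 * int N} \<subseteq> {2 * int J + 1..2 * int N}" using that by auto
      then have "{2 * int k + 1..2 * int N} \<subseteq> Y" using run by blast
      moreover have "{1..2 * int N} = {1..2 * int k} \<union> {2 * int k + 1..2 * int N}" using that by auto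
      ultimately show ?thesis by blast
    qed
    moreover have "(Y \<inter> {1..2 * int k}) \<inter> {2 * int k + 1..2 * int N} = {}" by auto
    ultimately have "card (Y \<inter> {1..2 * int N}) = card (Y \<inter> {1..2 * int k}) + nat (2 * int N - 2 * int k)"
      by (simp add: card_Un_disjoint)
    then show ?thesis using that by (simp add: balance_def)
  qed
  have lowest: "balance Y N \<le> balance Y j" if "J \<le> j" for j
  proof (cases "j \<le> N")
    case True
    then show ?thesis using inrun[OF that True] by linarith
  next
    case False
    then show ?thesis using balance_beyond[OF Y, of j] by linarith
  qed
  have "k \<notin> free_pairs m Y" if k: "J \<le> k" "k \<le> N" for k
  proof (cases "k = N")
    case True
    have "pair N \<inter> Y \<noteq> {}"
    proof (cases "J = N")
      case False
      then have "2 * int N \<in> Y" using run JN by auto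
      then show ?thesis by (auto simp: pair_def)
    qed (use last in simp)
    then show ?thesis using True by (simp add: free_pairs_def)
  next
    case False
    then have "balance Y N < balance Y k" using inrun[OF k] k by linarith
    then have "\<not> balance Y k \<le> balance Y N" by simp
    then show ?thesis using k(2) unfolding free_pairs_def by blast
  qed
  then have mid: "free_pairs m Y \<inter> {J..N} = {}" by auto
  have "free_pairs m Y = (free_pairs m Y \<inter> {..<J}) \<union> (free_pairs m Y \<inter> {J..N}) \<union> (free_pairs m Y \<inter> {N<..})"
    using JN by (intro nat_set_split) simp
  moreover have "free_pairs m Y \<inter> {..<J} = low_free_pairs m Y J (balance Y N)"
    by (rule free_pairs_below[OF JN]) (rule lowest)
  ultimately show ?thesis unfolding mid free_pairs_beyond[OF Y] by simp
qed

text \<open>Compare the run \<open>{q - r..q}\<close>, which ends with the full pair \<open>K\<close>, with the run shortened by one and moved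
down to \<open>{q - r - 1..q - 2}\<close>. Both are followed only by empty pairs, and the balance takes the same value
at the end of either run, that is at \<open>K\<close> and at \<open>K - 1\<close>. So the same pairs are free below the run, and
the same number of pairs is free directly after it.\<close>
lemma free_pairs_shift_run:
  assumes Y0: "Y0 \<subseteq> {1..q - r - 2}" and q: "q = 2 * int K" and r: "1 \<le> r" "2 \<le> q - r"
  obtains A d where "\<And>x. x \<in> pairs A \<Longrightarrow> 1 \<le> x \<and> x \<le> q - r - 2"
    "free_pairs m (Y0 \<union> {q - r..q}) = A \<union> {Suc K..K + d}"
    "free_pairs m (Y0 \<union> {q - r - 1..q - 2}) = A \<union> {K..<K + d}"
proof -
  \<comment> \<open>The pair of \<open>q - r - 1\<close>, the lowest pair in which the two sets can differ.\<close>
  define J where "J = nat ((q - r) div 2)"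
  let ?Y = "Y0 \<union> {q - r..q}" and ?Z = "Y0 \<union> {q - r - 1..q - 2}"
  have intJ: "int J = (q - r) div 2" using r by (simp add: J_def)
  then have J: "q - r - 1 \<le> 2 * int J" "2 * int J \<le> q - r" by linarith+
  have JK: "J < K" using J q r by linarith
  obtain N where N: "K = Suc N" using JK by (cases K) auto
  have q2: "q - 2 = 2 * int N" using q N by simp
  define A where "A = low_free_pairs m ?Y J (balance ?Y K)"
  have fin: "finite Y0" using Y0 finite_subset by blast
  have "Y0 \<inter> {q - r..q} = {}" "Y0 \<inter> {q - r - 1..q - 2} = {}" using Y0 by auto
  then have cards: "card ?Y = card Y0 + nat (r + 1)" "card ?Z = card Y0 + nat r"
    using fin by (simp_all add: card_Un_disjoint)
  have subs: "?Y \<subseteq> {1..2 * int K}" "?Z \<subseteq> {1..2 * int N}" using Y0 r q q2 by force+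
  then have "?Y \<inter> {1..2 * int K} = ?Y" "?Z \<inter> {1..2 * int N} = ?Z" by blast+
  then have bal: "balance ?Z N = balance ?Y K"
    using cards r N by (simp add: balance_def)
  have cong: "low_free_pairs m ?Z J v = A" if "v = balance ?Y K" for v
    unfolding A_def that using J by (intro low_free_pairs_cong) auto
  have Y': "free_pairs m ?Y = A \<union> {Suc K..K + nat (int m - balance ?Y K)}"
    unfolding A_def
  proof (rule free_pairs_full_run[OF subs(1)])
    have "{2 * int J + 1..2 * int K} \<subseteq> {q - r..q}" using J q by auto
    then show "{2 * int J + 1..2 * int K} \<subseteq> ?Y" by blast
  qed (use JK in simp_all)
  have "free_pairs m ?Z =
      low_free_pairs m ?Z J (balance ?Z N) \<union> {Suc N..N + nat (int m - balance ?Z N)}"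
  proof (rule free_pairs_full_run[OF subs(2)])
    have "{2 * int J + 1..2 * int N} \<subseteq> {q - r - 1..q - 2}" using J q2 by auto
    then show "{2 * int J + 1..2 * int N} \<subseteq> ?Z" by blast
    show "J \<le> N" using JK N by simp
    assume "J = N"
    then have "2 * int J \<in> {q - r - 1..q - 2}" using q2 r by simp
    then show "pair J \<inter> ?Z \<noteq> {}" by (auto simp: pair_def)
  qed
  then have Z': "free_pairs m ?Z = A \<union> {K..<K + nat (int m - balance ?Y K)}"
    unfolding cong[OF bal] unfolding bal by (simp add: N atLeastLessThanSuc_atLeastAtMost)
  have bounds: "1 \<le> x \<and> x \<le> q - r - 2" if x: "x \<in> pairs A" for x
  proof -
    obtain k where k: "k \<in> A" "x = 2 * int k - 1 \<or> x = 2 * int k" using x unfolding in_pairs_iff by blast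
    then have "k \<in> {1..<J}" using low_free_pairs_subset unfolding A_def by blast
    then have "1 \<le> k" "k < J" by simp_all
    then show ?thesis using k(2) J by linarith
  qed
  show thesis by (rule that[OF bounds Y' Z'])
qed

section \<open>Removing the last entry of a column\<close>

lemma pairs_Un: "pairs (A \<union> B) = pairs A \<union> pairs B"
  by (auto simp: pairs_def)

lemma pairs_remove: "pairs (A - {k}) = pairs A - pair k"
proof
  show "pairs A - pair k \<subseteq> pairs (A - {k})" by (auto simp: pairs_def)
  show "pairs (A - {k}) \<subseteq> pairs A - pair k"
  proof -
    have "pair k \<inter> pairs (A - {k}) = {}" by (simp add: pair_meets_pairs_iff)
    moreover have "pairs (A - {k}) \<subseteq> pairs A" by (auto simp: pairs_def)
    ultimately show ?thesis by blast
  qed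
qed

lemma pair_eq_parity_inv:
  assumes "x \<in> pair k"
  shows "pair k = {x, parity_inv x}"
  using assms by (auto simp: pair_def parity_inv_def)

lemma disj_union_of_2: "disj_union_of X [A, B] \<longleftrightarrow> X = A \<union> B \<and> A \<inter> B = {}"
  by (simp add: disj_union_of_def disjnt_def)

lemma disj_union_of_3:
  "disj_union_of X [A, B, C] \<longleftrightarrow> X = A \<union> B \<union> C \<and> A \<inter> B = {} \<and> A \<inter> C = {} \<and> B \<inter> C = {}"
  by (auto simp: disj_union_of_def disjnt_def)

lemma red_lengths_pred:
  assumes "t \<in> red_lengths n l" "1 \<le> t" "l \<le> 2 * n"
  shows "t - 1 \<in> red_lengths n (l - 1)" "l - 1 - (t - 1) = l - t"
  using assms by (auto simp: red_lengths_def)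

lemma SpT_take:
  assumes "b \<in> SpT n t" "j \<le> t"
  shows "take j b \<in> SpT n j"
proof -
  note b = SST_D[OF SpT_D(1)[OF assms(1)]]
  have entries: "entry (take j b) i \<ge> 2 * int i - 1" if "i \<in> {1..j}" for i
  proof -
    have "entry (take j b) i = entry b i" using that by (cases i) (simp_all add: entry_def)
    moreover have "i \<in> {1..length b}" using that b(3) assms(2) by simp
    ultimately show ?thesis using SpT_D(2)[OF assms(1)] by (simp add: symplectic_def)
  qed
  have len: "length (take j b) = j" using b(3) assms(2) by simp
  have "symplectic (take j b)" unfolding symplectic_def len using entries by blast
  moreover have "set (take j b) \<subseteq> {1..2 * int n}" using b(2) set_take_subset[of j b] by blast
  ultimately show ?thesis
    using sorted_wrt_take[OF b(1)] len by (simp add: SpT_def SST_def)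
qed

lemma SST_equality:
  assumes "a \<in> SST n k" "a' \<in> SST n k'" "set a = set a'"
  shows "a = a'"
  using strict_sorted_equal[OF SST_D(1)[OF assms(1)] SST_D(1)[OF assms(2)]] assms(3) by simp

lemma red_inv_full_length:
  assumes "b \<in> SpT n l" "l \<in> red_lengths n l" "l \<le> 2 * n"
  shows "red_inv n l b = b"
proof (rule SST_equality)
  show a: "red_inv n l b \<in> SST n l" by (rule red_inv_SpT(1)[OF assms])
  show b: "b \<in> SST n l" by (rule SpT_D(1)[OF assms(1)])
  have "set b \<subseteq> set (red_inv n l b)" unfolding red_inv_SpT(2)[OF assms] by blast
  then show "set (red_inv n l b) = set b"
    using card_subset_eq[of "set (red_inv n l b)" "set b"] SST_D(4)[OF a] SST_D(4)[OF b] by simp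
qed

lemma SpT_0: "SpT n 0 = {[]}" "SST n 0 = {[]}"
  by (auto simp: SpT_def SST_def symplectic_def)

lemma red_inv_Nil:
  assumes "0 \<in> red_lengths n l" "l \<le> 2 * n"
  shows "red_inv n l [] = [1..int l]"
proof (rule SST_equality)
  have b: "[] \<in> SpT n 0" by (simp add: SpT_0)
  show "red_inv n l [] \<in> SST n l" by (rule red_inv_SpT(1)[OF b assms])
  show "[1..int l] \<in> SST n l" using assms(2) by (auto simp: SST_def)
  define m where "m = l div 2"
  have m: "int l = 2 * int m" using assms(1) by (auto simp: m_def red_lengths_def)
  have "free_pairs m {} \<inter> {0<..} = free_pairs m {}" by (auto simp: free_pairs_def)
  then have "free_pairs m {} = {Suc 0..0 + m}"
    using free_pairs_beyond[of "{}" 0 m] by simp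
  then have "pairs (free_pairs m {}) = {1..2 * int m}" using pairs_atLeastAtMost[of 0 m] by simp
  then show "set (red_inv n l []) = set [1..int l]"
    unfolding red_inv_SpT(2)[OF b assms] m by (simp add: m_def)
qed

text \<open>Filling the pairs of \<open>T \<union> U\<close>, except that the pair \<open>{x, y}\<close> keeps only \<open>x\<close>, amounts to filling \<open>T\<close>
completely, deleting \<open>y\<close> and appending \<open>U\<close>.\<close>
lemma fill_around_single:
  assumes "x \<in> T" "x \<notin> U" "y \<notin> Y \<union> P" "y \<notin> U" "y \<noteq> x"
  shows "insert x Y \<union> P \<union> (T \<union> U - {x, y}) = (Y \<union> P \<union> T - {y}) \<union> U"
  using assms by (intro set_eqI) (simp, metis)

text \<open>Here \<open>e\<close> is the upper end of the pair of the second largest entry \<open>p\<close> (and \<open>0\<close> if there is none), and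
\<open>s\<close> counts the letters in the free pairs above it that are filled for the shortened column. The
condition \<open>q \<le> e + s\<close> says that the pair of \<open>q\<close> is one of them.\<close>
lemma red_inv_append_last:
  assumes b: "b \<in> SpT n t" and t: "t \<in> red_lengths n l" "1 \<le> t" and l: "l \<le> 2 * n"
    and p: "p = entry b (t - 1)" and q: "q = entry b t"
    and npair: "\<not> (even q \<and> p = q - 1)"
    and e: "e = (if even p then p else p + 1)"
    and ahat: "ahat = red_inv n (l - 1) (take (t - 1) b)"
  obtains s where "0 \<le> s" "even s" "s + int (card (set ahat \<inter> {1..p})) = int l - 1"
    "set ahat = (set ahat \<inter> {1..p}) \<union> {e + 1..e + s}" "e < q" "2 \<le> t \<Longrightarrow> 1 \<le> p \<and> p \<in> set ahat"
    "ahat \<in> SST n (l - 1)"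
    "set (red_inv n l b) = (if q \<le> e + s then (set ahat - {parity_inv q}) \<union> {e + s + 1..e + s + 2}
       else set ahat \<union> {q})"
proof -
  define m where "m = (l - t) div 2"
  define Y where "Y = set (take (t - 1) b)"
  note bS = SST_D[OF SpT_D(1)[OF b]]
  have b': "take (t - 1) b \<in> SpT n (t - 1)" using SpT_take[OF b] by simp
  have bq: "b = take (t - 1) b @ [q]"
    using bS(3) t(2) take_Suc_conv_app_nth[of "t - 1" b] by (simp add: q entry_def)
  have setb: "set b = insert q Y" unfolding Y_def by (subst bq) simp
  have Yq: "y < q" if "y \<in> Y" for y
  proof -
    have "sorted_wrt (<) (take (t - 1) b @ [q])" using bq bS(1) by simp
    then show ?thesis using that by (simp add: sorted_wrt_append Y_def)
  qed
  have q1: "1 \<le> q" using setb bS(2) by auto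
  have pY: "1 \<le> p \<and> p \<in> Y \<and> (\<forall>y\<in>Y. y \<le> p)" if "2 \<le> t"
  proof -
    obtain v where v: "t = Suc (Suc v)" using \<open>2 \<le> t\<close> by (metis Suc_le_D numeral_2_eq_2 Suc_le_mono)
    then have take: "take (t - 1) b = take v b @ [p]"
      using bS(3) by (simp add: p entry_def take_Suc_conv_app_nth)
    then have "sorted_wrt (<) (take v b @ [p])"
      using sorted_wrt_take[OF bS(1), of "t - 1"] by simp
    then have "y \<le> p" if "y \<in> Y" for y
      using that unfolding Y_def take by (auto simp: sorted_wrt_append)
    moreover have "p \<in> Y" unfolding Y_def take by simp
    moreover from this have "1 \<le> p" using bS(2) setb by auto
    ultimately show ?thesis by blast
  qed
  have p0: "p = 0 \<and> Y = {}" if "\<not> 2 \<le> t"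
    using that t(2) by (simp add: p Y_def entry_def)
  have p_bounds: "0 \<le> p" "p < q" "Y \<subseteq> {1..p}"
  proof -
    show "0 \<le> p" using pY p0 by (cases "2 \<le> t") auto
    show "p < q" using pY p0 Yq q1 by (cases "2 \<le> t") auto
    have "Y \<subseteq> {1..}" using bS(2) setb by auto
    then show "Y \<subseteq> {1..p}" using pY p0 by (cases "2 \<le> t") auto
  qed
  have eq: "e < q" using e p_bounds npair by (auto split: if_splits) presburger+
  have e': "even e" "p \<le> e" "e \<le> p + 1" "0 \<le> e" using p_bounds(1) by (auto simp: e)
  define J where "J = nat (e div 2)"
  have J: "2 * int J = e" using e' by (simp add: J_def)
  define K where "K = nat ((q + 1) div 2)"
  have "int K = (q + 1) div 2" using q1 by (simp add: K_def)
  then have K: "q \<in> pair K" by (simp add: pair_def; presburger)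
  have JK: "J < K" using K J eq by (auto simp: pair_def)
  have "Y \<subseteq> {1..2 * int J}" using p_bounds(3) e' J by auto
  moreover have "J = 0 \<or> pair J \<inter> Y \<noteq> {}"
  proof (cases "2 \<le> t")
    case True
    have "p \<in> pair J" using J e by (simp add: pair_def split: if_splits)
    then show ?thesis using pY[OF True] by blast
  next
    case False
    then show ?thesis using p0 J e by simp
  qed
  ultimately obtain A d where A: "A \<subseteq> {1..<J}" "free_pairs m Y = A \<union> {Suc J..J + d}"
    "free_pairs m (insert q Y) =
       A \<union> (if K \<le> J + d then {Suc J..Suc (J + d)} - {K} else {Suc J..J + d})"
    using free_pairs_insert_greatest[OF _ _ K JK, of Y m] by metis
  define s where "s = 2 * int d"
  have tail: "pairs {Suc J..J + d} = {e + 1..e + s}"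
    "pairs {Suc J..Suc (J + d)} = {e + 1..e + s + 2}"
    using pairs_atLeastAtMost[of J d] pairs_atLeastAtMost[of J "Suc d"] J by (simp_all add: s_def)
  have l1: "l - 1 \<le> 2 * n" using l by simp
  have set_ahat: "set ahat = Y \<union> pairs A \<union> {e + 1..e + s}"
    unfolding ahat red_inv_SpT(2)[OF b' red_lengths_pred(1)[OF t l] l1] red_lengths_pred(2)[OF t l]
    using A(2) tail by (simp add: Y_def m_def pairs_Un Un_assoc)
  have "pairs A \<subseteq> {1..p}"
  proof
    fix x assume "x \<in> pairs A"
    then obtain k where "k \<in> A" "x = 2 * int k - 1 \<or> x = 2 * int k" unfolding in_pairs_iff by blast
    moreover from this have "k \<in> {1..<J}" using A(1) by blast
    ultimately have "1 \<le> x" "x \<le> 2 * int J - 2" by auto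
    then show "x \<in> {1..p}" using J e' by simp
  qed
  then have low: "set ahat \<inter> {1..p} = Y \<union> pairs A"
    using set_ahat p_bounds(3) e' by auto
  have split: "set ahat = (set ahat \<inter> {1..p}) \<union> {e + 1..e + s}" unfolding low by (rule set_ahat)
  have ahatS: "ahat \<in> SST n (l - 1)"
    unfolding ahat by (rule red_inv_SpT(1)[OF b' red_lengths_pred(1)[OF t l] l1])
  have tl: "1 \<le> l" using t by (auto simp: red_lengths_def)
  show thesis
  proof
    show "0 \<le> s" "even s" by (simp_all add: s_def)
    show "set ahat = (set ahat \<inter> {1..p}) \<union> {e + 1..e + s}" by (rule split)
    show "e < q" by (rule eq)
    show "ahat \<in> SST n (l - 1)" by (rule ahatS)
    show "1 \<le> p \<and> p \<in> set ahat" if "2 \<le> t" using pY[OF that] set_ahat by blast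
    have "card (set ahat) = card (set ahat \<inter> {1..p}) + card {e + 1..e + s}"
      using e' by (subst split, intro card_Un_disjoint) auto
    then show "s + int (card (set ahat \<inter> {1..p})) = int l - 1"
      using SST_D(4)[OF ahatS] tl by (simp add: s_def)
    have KJ: "K \<le> J + d \<longleftrightarrow> q \<le> e + s" using K J by (auto simp: pair_def s_def)
    have set_a: "set (red_inv n l b) = insert q Y \<union> pairs A \<union>
        (if q \<le> e + s then {e + 1..e + s + 2} - {q, parity_inv q} else {e + 1..e + s})"
      unfolding red_inv_SpT(2)[OF b t(1) l] setb m_def[symmetric] A(3) KJ
      by (simp add: pairs_Un pairs_remove tail pair_eq_parity_inv[OF K] Un_assoc)
    show "set (red_inv n l b) = (if q \<le> e + s then (set ahat - {parity_inv q}) \<union> {e + s + 1..e + s + 2}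
       else set ahat \<union> {q})"
    proof (cases "q \<le> e + s")
      case True
      have "e < parity_inv q" "parity_inv q \<le> e + s" "parity_inv q \<noteq> q"
        using True eq e'(1) s_def by (auto simp: parity_inv_def; presburger)+
      moreover have "Y \<union> pairs A \<subseteq> {1..p}" using low by blast
      moreover have "{1..p} \<subseteq> {..e}" using e'(2) by auto
      ultimately have "parity_inv q \<notin> Y \<union> pairs A" by (meson atMost_iff not_le subsetD)
      have "{e + 1..e + s + 2} = {e + 1..e + s} \<union> {e + s + 1..e + s + 2}"
        using s_def by auto
      with True set_a have "set (red_inv n l b) = insert q Y \<union> pairs A \<union>
          (({e + 1..e + s} \<union> {e + s + 1..e + s + 2}) - {q, parity_inv q})" by (simp only: if_True)
      also have "\<dots> = (set ahat - {parity_inv q}) \<union> {e + s + 1..e + s + 2}"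
        unfolding set_ahat
      proof (rule fill_around_single)
        show "q \<in> {e + 1..e + s}" using True eq by simp
        show "q \<notin> {e + s + 1..e + s + 2}" using True by simp
        show "parity_inv q \<notin> {e + s + 1..e + s + 2}" using \<open>parity_inv q \<le> e + s\<close> by simp
      qed fact+
      finally have "set (red_inv n l b) = (set ahat - {parity_inv q}) \<union> {e + s + 1..e + s + 2}" .
      then show ?thesis using True by (simp only: if_True)
    next
      case False
      with set_a have "set (red_inv n l b) = insert q Y \<union> pairs A \<union> {e + 1..e + s}"
        by (simp only: if_False)
      then have "set (red_inv n l b) = set ahat \<union> {q}" unfolding set_ahat by blast
      then show ?thesis using False by (simp only: if_False)
    qed
  qed
qed

section \<open>Columns ending with an interval fixed by the parity involution\<close>

lemma sorted_run_suffix: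
  fixes b :: "int list"
  assumes "sorted_wrt (<) b" "{x..y} \<subseteq> set b" "\<And>z. z \<in> set b \<Longrightarrow> z \<le> y"
  shows "b = filter (\<lambda>z. z < x) b @ [x..y]"
proof (rule strict_sorted_equal[symmetric])
  show "sorted_wrt (<) b" by (rule assms(1))
  show "sorted_wrt (<) (filter (\<lambda>z. z < x) b @ [x..y])"
    using assms(1) by (auto simp: sorted_wrt_append sorted_wrt_filter)
  show "set (filter (\<lambda>z. z < x) b @ [x..y]) = set b"
    using assms(2,3) by (auto simp: not_less)
qed

lemma has_fixed_interval_suffix_iff:
  assumes "sorted_wrt (<) b" "b \<noteq> []"
  shows "has_fixed_interval_suffix b \<longleftrightarrow> even (last b) \<and> last b - 1 \<in> set b"
proof
  assume "has_fixed_interval_suffix b"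
  then obtain c x y where c: "suffix c b" "c \<noteq> []" "c = [x..y]" "parity_inv ` set c = set c"
    unfolding has_fixed_interval_suffix_def by blast
  have xy: "x \<le> y" using c by simp
  have "last c = y" unfolding c(3) using xy by (simp add: upto_rec2)
  moreover have "last b = last c" using c(1,2) by (auto simp: suffix_def)
  moreover have "parity_inv y \<in> set c" using c xy by auto
  moreover have "set c \<subseteq> set b" using c(1) by (auto simp: suffix_def)
  ultimately show "even (last b) \<and> last b - 1 \<in> set b"
    using c(3) by (auto simp: parity_inv_def split: if_splits)
next
  assume r: "even (last b) \<and> last b - 1 \<in> set b"
  define y where "y = last b"
  have top: "z \<le> y" if "z \<in> set b" for z
  proof -
    have "b = butlast b @ [y]" using assms(2) by (simp add: y_def)
    then have "sorted_wrt (<) (butlast b @ [y])" "z \<in> set (butlast b @ [y])"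
      using assms(1) that by metis+
    then show ?thesis by (auto simp: sorted_wrt_append)
  qed
  have "{y - 1..y} = {y - 1, y}" by auto
  then have "{y - 1..y} \<subseteq> set b" using r assms(2) by (simp add: y_def)
  then have "b = filter (\<lambda>z. z < y - 1) b @ [y - 1..y]"
    using sorted_run_suffix[OF assms(1)] top by blast
  then have "suffix [y - 1..y] b" unfolding suffix_def by blast
  moreover have "parity_inv ` {y - 1..y} = {y - 1..y}"
    unfolding \<open>{y - 1..y} = {y - 1, y}\<close> using r by (auto simp: parity_inv_def y_def)
  ultimately show "has_fixed_interval_suffix b"
    unfolding has_fixed_interval_suffix_def
    by (intro exI[of _ "[y - 1..y]"] conjI) (auto)
qed

section \<open>The case distinctions\<close>

lemma entry_last: "b \<noteq> [] \<Longrightarrow> entry b (length b) = last b"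
  by (simp add: entry_def last_conv_nth)

lemma entry_in_set: "1 \<le> i \<Longrightarrow> i \<le> length b \<Longrightarrow> entry b i \<in> set b"
  by (simp add: entry_def)

text \<open>All conditions in the case distinction on the last entry \<open>q\<close> come down to whether the pair of \<open>q\<close> lies in
the filled block \<open>{e + 1..e + s}\<close>. Since \<open>e\<close> and \<open>s\<close> are even, \<open>q\<close> and its partner are both inside or
both outside.\<close>
lemma last_entry_cases:
  fixes p q e s :: int
  assumes s: "0 \<le> s" "even s" and e: "e = (if even p then p else p + 1)" "e < q"
    and pos: "\<forall>x\<in>H. 1 \<le> x"
    and p: "0 \<le> p"
    and H: "H = (H \<inter> {1..p}) \<union> {e + 1..e + s}"
    and S: "S = (if q \<le> e + s then (H - {parity_inv q}) \<union> {e + s + 1..e + s + 2} else H \<union> {q})"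
  shows "q \<in> H \<longleftrightarrow> q \<le> e + s" "parity_inv q \<in> H \<longleftrightarrow> q \<le> e + s"
    and "H \<subseteq> {1..q - 1} \<longleftrightarrow> \<not> q \<le> e + s" "even q \<Longrightarrow> H \<subseteq> {1..q - 2} \<longleftrightarrow> \<not> q \<le> e + s"
    and "q \<le> e + s \<Longrightarrow> disj_union_of S [H - {parity_inv q}, {e + s + 1..e + s + 2}]"
    and "\<not> q \<le> e + s \<Longrightarrow> disj_union_of S [H, {q}]"
proof -
  have ev: "even e" "p \<le> e" "0 \<le> e" using e(1) p by auto
  have le: "x \<le> e + s" if "x \<in> H" for x
  proof -
    have "x \<in> (H \<inter> {1..p}) \<union> {e + 1..e + s}" using H that by (rule subst)
    then show ?thesis using s ev by auto
  qed
  have mem: "x \<in> H" if "e < x" "x \<le> e + s" for x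
  proof -
    have "x \<in> (H \<inter> {1..p}) \<union> {e + 1..e + s}" using that by simp
    then show ?thesis by (rule subst[OF H[symmetric]])
  qed
  have par: "e < parity_inv q" "parity_inv q \<le> e + s \<longleftrightarrow> q \<le> e + s" "parity_inv q \<noteq> q"
    using e(2) ev(1) s(2) unfolding parity_inv_def by (split if_split, presburger)+
  show q: "q \<in> H \<longleftrightarrow> q \<le> e + s" using le[of q] mem[of q] e(2) by blast
  show "parity_inv q \<in> H \<longleftrightarrow> q \<le> e + s"
    using le[of "parity_inv q"] mem[of "parity_inv q"] par by blast
  show "H \<subseteq> {1..q - 1} \<longleftrightarrow> \<not> q \<le> e + s"
  proof
    assume "H \<subseteq> {1..q - 1}"
    then have "q \<notin> H" by auto
    then show "\<not> q \<le> e + s" using q by blast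
  next
    assume n: "\<not> q \<le> e + s"
    show "H \<subseteq> {1..q - 1}"
    proof
      fix x assume "x \<in> H"
      then show "x \<in> {1..q - 1}" using le[of x] pos n by simp
    qed
  qed
  show "H \<subseteq> {1..q - 2} \<longleftrightarrow> \<not> q \<le> e + s" if "even q"
  proof
    assume "H \<subseteq> {1..q - 2}"
    then have "q \<notin> H" by auto
    then show "\<not> q \<le> e + s" using q by blast
  next
    assume n: "\<not> q \<le> e + s"
    then have "e + s \<le> q - 2" using that ev(1) s(2) by presburger
    show "H \<subseteq> {1..q - 2}"
    proof
      fix x assume "x \<in> H"
      then show "x \<in> {1..q - 2}" using le[of x] pos \<open>e + s \<le> q - 2\<close> by simp
    qed
  qed
  show "disj_union_of S [H - {parity_inv q}, {e + s + 1..e + s + 2}]" if "q \<le> e + s"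
    unfolding disj_union_of_2
  proof
    show "S = (H - {parity_inv q}) \<union> {e + s + 1..e + s + 2}" using S that by (simp only: if_True)
    have "x \<notin> {e + s + 1..e + s + 2}" if "x \<in> H" for x using le[OF that] by simp
    then show "(H - {parity_inv q}) \<inter> {e + s + 1..e + s + 2} = {}" by blast
  qed
  show "disj_union_of S [H, {q}]" if "\<not> q \<le> e + s"
    unfolding disj_union_of_2
  proof
    show "S = H \<union> {q}" using S that by (simp only: if_False)
    show "H \<inter> {q} = {}" using q that by blast
  qed
qed

lemma red_inv_single:
  assumes "b \<in> SpT n 1" "1 \<in> red_lengths n l" "l \<le> 2 * n"
  shows "let q = entry b 1; a = red_inv n l b; ahat = red_inv n (l - 1) [] in
     b = [q] \<and> ahat = [1..int l - 1] \<and>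
     by_cases
      [(set ahat \<subseteq> {1..q - 1}, disj_union_of (set a) [set ahat, {q}]),
       (odd q \<and> q \<in> set ahat, disj_union_of (set a) [set ahat - {q + 1}, {int l..int l + 1}]),
       (even q \<and> q \<in> set ahat, disj_union_of (set a) [set ahat - {q - 1}, {int l..int l + 1}])]"
proof -
  define q where "q = entry b 1"
  define ahat where "ahat = red_inv n (l - 1) []"
  have len: "length b = 1" using SST_D(3)[OF SpT_D(1)[OF assms(1)]] .
  then obtain x where "b = [x]" by (cases b) auto
  then have bq: "b = [q]" by (simp add: q_def entry_def)
  have p: "0 = entry b (1 - 1)" by (simp add: entry_def)
  have q1: "1 \<le> q" using SST_D(2)[OF SpT_D(1)[OF assms(1)]] bq by auto
  have l1: "1 \<le> l" using assms(2) by (simp add: red_lengths_def)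
  have "0 \<in> red_lengths n (l - 1)" using red_lengths_pred(1)[OF assms(2) _ assms(3)] by simp
  then have ahat: "ahat = [1..int l - 1]"
    unfolding ahat_def using red_inv_Nil[of n "l - 1"] assms(3) l1 by (simp add: of_nat_diff)
  obtain s where s: "0 \<le> s" "even s" "s + int (card (set ahat \<inter> {1..0})) = int l - 1"
    "set ahat = (set ahat \<inter> {1..0}) \<union> {0 + 1..0 + s}" "0 < q"
    "set (red_inv n l b) = (if q \<le> 0 + s then (set ahat - {parity_inv q}) \<union> {0 + s + 1..0 + s + 2}
       else set ahat \<union> {q})"
  proof (rule red_inv_append_last[OF assms(1,2) _ assms(3) p q_def])
    show "\<not> (even q \<and> 0 = q - 1)" by presburger
    show "(0::int) = (if even (0::int) then 0 else 0 + 1)" by simp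
    show "ahat = red_inv n (l - 1) (take (1 - 1) b)" by (simp add: ahat_def)
  qed (use that in simp_all)
  have sl: "s + 1 = int l" "s + 2 = int l + 1" using s(3) by simp_all
  have iv: "{0 + s + 1..0 + s + 2} = {int l..int l + 1}" using sl by simp
  note summary = last_entry_cases[OF s(1,2) _ s(5) _ _ s(4,6)]
  have sm: "q \<in> set ahat \<longleftrightarrow> q \<le> s" "set ahat \<subseteq> {1..q - 1} \<longleftrightarrow> \<not> q \<le> s"
    "q \<le> s \<Longrightarrow> disj_union_of (set (red_inv n l b)) [set ahat - {parity_inv q}, {int l..int l + 1}]"
    "\<not> q \<le> s \<Longrightarrow> disj_union_of (set (red_inv n l b)) [set ahat, {q}]"
    using summary(1,3,5,6) ahat unfolding iv by simp_all
  have "by_cases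
      [(set ahat \<subseteq> {1..q - 1}, disj_union_of (set (red_inv n l b)) [set ahat, {q}]),
       (odd q \<and> q \<in> set ahat,
         disj_union_of (set (red_inv n l b)) [set ahat - {q + 1}, {int l..int l + 1}]),
       (even q \<and> q \<in> set ahat,
         disj_union_of (set (red_inv n l b)) [set ahat - {q - 1}, {int l..int l + 1}])]"
    using sm by (cases "q \<le> s"; cases "even q") (simp_all add: by_cases_def parity_inv_def)
  then show ?thesis
    unfolding Let_def q_def[symmetric] ahat_def[symmetric] using bq ahat by blast
qed

lemma red_inv_no_interval:
  assumes b: "b \<in> SpT n t" and t: "t \<in> red_lengths n l" "2 \<le> t" and l: "l \<le> 2 * n"
    and nfix: "\<not> has_fixed_interval_suffix b"
  shows "let p = entry b (t - 1); q = entry b t; a = red_inv n l b;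
             ahat = red_inv n (l - 1) (take (t - 1) b) in
              ahat \<in> SST n (l - 1) \<and>
              (\<exists>s::int. 0 \<le> s \<and> even s \<and>
                 s + int (card (set ahat \<inter> {1..p})) = int l - 1 \<and>
                 by_cases
                  [(even p,
                      disj_union_of (set ahat)
                        [set ahat \<inter> {1..p - 1}, {p}, {p + 1..p + s}]),
                   (odd p,
                      disj_union_of (set ahat)
                        [set ahat \<inter> {1..p - 1}, {p}, {p + 2..p + 1 + s}])] \<and>
                 by_cases
                  [(set ahat \<subseteq> {1..q - 1} \<and> odd q,
                      disj_union_of (set a) [set ahat, {q}]),
                   (q \<in> set ahat \<and> even p \<and> odd q,
                      disj_union_of (set a)
                        [set ahat - {parity_inv q}, {p + 1 + s..p + 2 + s}]),
                   (q \<in> set ahat \<and> odd p \<and> odd q,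
                      disj_union_of (set a)
                        [set ahat - {parity_inv q}, {p + 2 + s..p + 3 + s}]),
                   (set ahat \<subseteq> {1..q - 2} \<and> p < q - 1 \<and> even q,
                      disj_union_of (set a) [set ahat, {q}]),
                   (parity_inv q \<in> set ahat \<and> p < q - 1 \<and> even p \<and> even q,
                      disj_union_of (set a)
                        [set ahat - {parity_inv q}, {p + s + 1..p + s + 2}]),
                   (parity_inv q \<in> set ahat \<and> p < q - 1 \<and> odd p \<and> even q,
                      disj_union_of (set a)
                        [set ahat - {parity_inv q}, {p + s + 2..p + s + 3}])])"
proof -
  define p where "p = entry b (t - 1)"
  define q where "q = entry b t"
  define ahat where "ahat = red_inv n (l - 1) (take (t - 1) b)"
  define a where "a = red_inv n l b"
  define e where "e = (if even p then p else p + 1)"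
  note bS = SST_D[OF SpT_D(1)[OF b]]
  have ne: "b \<noteq> []" using bS(3) t(2) by auto
  have qlast: "q = last b" using entry_last[OF ne] bS(3) by (simp add: q_def)
  have pset: "p \<in> set b" using entry_in_set[of "t - 1" b] bS(3) t(2) by (simp add: p_def)
  have npair: "\<not> (even q \<and> p = q - 1)"
    using nfix has_fixed_interval_suffix_iff[OF bS(1) ne] pset by (auto simp: qlast)
  have t1: "1 \<le> t" using t(2) by simp
  obtain s where s: "0 \<le> s" "even s" "s + int (card (set ahat \<inter> {1..p})) = int l - 1"
    "set ahat = (set ahat \<inter> {1..p}) \<union> {e + 1..e + s}" "e < q" "1 \<le> p \<and> p \<in> set ahat"
    "ahat \<in> SST n (l - 1)"
    "set a = (if q \<le> e + s then (set ahat - {parity_inv q}) \<union> {e + s + 1..e + s + 2}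
       else set ahat \<union> {q})"
    using red_inv_append_last[OF b t(1) t1 l p_def q_def npair e_def ahat_def] t(2)
    unfolding a_def by metis
  have pos: "\<forall>x\<in>set ahat. 1 \<le> x" using SST_D(2)[OF s(7)] by auto
  have p0: "0 \<le> p" using s(6) by simp
  note sm = last_entry_cases[OF s(1,2) e_def s(5) pos p0 s(4,8)]
  have pe: "p \<le> e" by (simp add: e_def)
  have disj: "disj_union_of (set ahat) [set ahat \<inter> {1..p - 1}, {p}, {e + 1..e + s}]"
    unfolding disj_union_of_3
  proof (intro conjI)
    have "{1..p} = {1..p - 1} \<union> {p}" using s(6) by auto
    then have "set ahat \<inter> {1..p} = (set ahat \<inter> {1..p - 1}) \<union> {p}" using s(6) by blast
    then show "set ahat = (set ahat \<inter> {1..p - 1}) \<union> {p} \<union> {e + 1..e + s}"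
      using s(4) by (simp only:)
  qed (use pe in auto)
  have plt: "even q \<Longrightarrow> p < q - 1" using s(5) pe npair by (cases "p = q - 1") auto
  have "by_cases
      [(even p, disj_union_of (set ahat) [set ahat \<inter> {1..p - 1}, {p}, {p + 1..p + s}]),
       (odd p, disj_union_of (set ahat) [set ahat \<inter> {1..p - 1}, {p}, {p + 2..p + 1 + s}])]"
  proof -
    have tail: "{e + 1..e + s} = (if even p then {p + 1..p + s} else {p + 2..p + 1 + s})"
      by (auto simp: e_def)
    show ?thesis using disj unfolding tail by (cases "even p") (simp_all add: by_cases_def)
  qed
  moreover have "by_cases
                  [(set ahat \<subseteq> {1..q - 1} \<and> odd q,
                      disj_union_of (set a) [set ahat, {q}]),
                   (q \<in> set ahat \<and> even p \<and> odd q,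
                      disj_union_of (set a)
                        [set ahat - {parity_inv q}, {p + 1 + s..p + 2 + s}]),
                   (q \<in> set ahat \<and> odd p \<and> odd q,
                      disj_union_of (set a)
                        [set ahat - {parity_inv q}, {p + 2 + s..p + 3 + s}]),
                   (set ahat \<subseteq> {1..q - 2} \<and> p < q - 1 \<and> even q,
                      disj_union_of (set a) [set ahat, {q}]),
                   (parity_inv q \<in> set ahat \<and> p < q - 1 \<and> even p \<and> even q,
                      disj_union_of (set a)
                        [set ahat - {parity_inv q}, {p + s + 1..p + s + 2}]),
                   (parity_inv q \<in> set ahat \<and> p < q - 1 \<and> odd p \<and> even q,
                      disj_union_of (set a)
                        [set ahat - {parity_inv q}, {p + s + 2..p + s + 3}])]"
  proof (cases "q \<le> e + s")
    case True
    have d: "disj_union_of (set a) [set ahat - {parity_inv q}, {e + s + 1..e + s + 2}]"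
      using sm(5) True .
    have "even p \<Longrightarrow> {p + 1 + s..p + 2 + s} = {e + s + 1..e + s + 2}"
      "odd p \<Longrightarrow> {p + 2 + s..p + 3 + s} = {e + s + 1..e + s + 2}"
      "even p \<Longrightarrow> {p + s + 1..p + s + 2} = {e + s + 1..e + s + 2}"
      "odd p \<Longrightarrow> {p + s + 2..p + s + 3} = {e + s + 1..e + s + 2}"
      by (simp_all add: e_def add.commute add.left_commute)
    then have "even p \<Longrightarrow> disj_union_of (set a) [set ahat - {parity_inv q}, {p + 1 + s..p + 2 + s}]"
      "odd p \<Longrightarrow> disj_union_of (set a) [set ahat - {parity_inv q}, {p + 2 + s..p + 3 + s}]"
      "even p \<Longrightarrow> disj_union_of (set a) [set ahat - {parity_inv q}, {p + s + 1..p + s + 2}]"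
      "odd p \<Longrightarrow> disj_union_of (set a) [set ahat - {parity_inv q}, {p + s + 2..p + s + 3}]"
      using d by (simp_all only: not_False_eq_True)
    then show ?thesis
      using True sm(1-4) plt unfolding by_cases_def by (cases "even p"; cases "even q") simp_all
  next
    case False
    show ?thesis
      using False sm(1-4) sm(6)[OF False] plt unfolding by_cases_def by (cases "even q") simp_all
  qed
  ultimately show ?thesis
    unfolding Let_def p_def[symmetric] q_def[symmetric] ahat_def[symmetric] a_def[symmetric]
    using s(1-3,7) by blast
qed

text \<open>The run is chosen of maximal length, so the letter directly below it is missing. It cannot start at \<open>1\<close>:
a symplectic column does not contain both \<open>1\<close> and \<open>2\<close>.\<close>
lemma maximal_run:
  assumes b: "b \<in> SpT n t" and t: "2 \<le> t" and fixed: "has_fixed_interval_suffix b"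
  obtains r where "1 \<le> r" "r < t" "even (entry b t)"
    "b = take (t - r - 1) b @ [entry b t - int r..entry b t]"
    "set (take (t - r - 1) b) \<subseteq> {1..entry b t - int r - 2}" "2 \<le> entry b t - int r"
proof -
  define q where "q = entry b t"
  note bS = SST_D[OF SpT_D(1)[OF b]]
  have ne: "b \<noteq> []" using bS(3) t by auto
  have qlast: "q = last b" using entry_last[OF ne] bS(3) by (simp add: q_def)
  have q: "even q" "q - 1 \<in> set b"
    using fixed has_fixed_interval_suffix_iff[OF bS(1) ne] by (simp_all add: qlast)
  have top: "z \<le> q" if "z \<in> set b" for z
  proof -
    have "b = butlast b @ [q]" using ne by (simp add: qlast)
    then have "sorted_wrt (<) (butlast b @ [q])" "z \<in> set (butlast b @ [q])"
      using bS(1) that by metis+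
    then show ?thesis by (auto simp: sorted_wrt_append)
  qed
  have "q - int (nat q) - 1 \<notin> set b"
  proof -
    have "x \<noteq> 0" "x \<noteq> -1" if "x \<in> set b" for x using bS(2) that by auto
    moreover have "q \<in> set b" using ne by (simp add: qlast)
    then have "0 \<le> q" using bS(2) by auto
    ultimately show ?thesis by force
  qed
  \<comment> \<open>The length, less one, of the maximal run ending at \<open>q\<close>.\<close>
  define r where "r = (LEAST r. q - int r - 1 \<notin> set b)"
  have out: "q - int r - 1 \<notin> set b" unfolding r_def by (rule LeastI) fact
  have inside: "q - int i - 1 \<in> set b" if "i < r" for i
    using not_less_Least that unfolding r_def by blast
  have "r \<noteq> 0" using out q(2) by (cases r) auto
  then have r1: "1 \<le> r" by simp
  have run: "{q - int r..q} \<subseteq> set b"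
  proof
    fix x assume x: "x \<in> {q - int r..q}"
    show "x \<in> set b"
    proof (cases "x = q")
      case True
      then show ?thesis using ne by (simp add: qlast)
    next
      case False
      then have "nat (q - x - 1) < r" "x = q - int (nat (q - x - 1)) - 1" using x r1 by auto
      then show ?thesis using inside by metis
    qed
  qed
  define b' where "b' = filter (\<lambda>z. z < q - int r) b"
  have split: "b = b' @ [q - int r..q]"
    unfolding b'_def by (rule sorted_run_suffix[OF bS(1) run top])
  have "length b = length (b' @ [q - int r..q])" by (rule arg_cong[OF split])
  then have "length b = length b' + (r + 1)" by (simp add: nat_add_distrib)
  then have len: "length b' = t - r - 1" "r < t" using bS(3) by simp_all
  have take: "take (t - r - 1) b = b'" by (subst split) (simp add: len)
  have low: "set b' \<subseteq> {1..q - int r - 2}"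
  proof
    fix x assume x: "x \<in> set b'"
    then have "x \<in> set b" "x < q - int r" by (auto simp: b'_def)
    moreover from this have "x \<noteq> q - int r - 1" "1 \<le> x" using out bS(2) by auto
    ultimately show "x \<in> {1..q - int r - 2}" by simp
  qed
  have "2 \<le> q - int r"
  proof (rule ccontr)
    assume "\<not> 2 \<le> q - int r"
    then have "{1..2} \<subseteq> {q - int r..q}" using q(1) r1 bS(2) top run
    proof -
      have "q - int r \<in> set b" using run by auto
      then have "1 \<le> q - int r" using bS(2) by auto
      then show ?thesis using r1 \<open>\<not> 2 \<le> q - int r\<close> by auto
    qed
    then have "{1..2} \<subseteq> set b" using run by blast
    then have "set b \<inter> {1..2 * int 1} = {1..2}" by auto
    then show False using symplectic_balance_nonneg[OF b, of 1] by (simp add: balance_def)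
  qed
  then show thesis
    using that[of r] r1 len(2) q(1) split low unfolding q_def[symmetric] take by (simp only:)
qed

text \<open>From the moved run on, each entry is the entry with the next index in \<open>b\<close> lowered by \<open>2\<close>, and the
symplectic bound for the next index is larger by \<open>2\<close>.\<close>
lemma SpT_shift_run:
  assumes b: "b \<in> SpT n t" and r: "1 \<le> r" "r < t"
    and split: "b = b' @ [q - int r..q]" "length b' = t - r - 1"
    and low: "set b' \<subseteq> {1..q - int r - 2}" and q: "2 \<le> q - int r"
  shows "b' @ [q - int r - 1..q - 2] \<in> SpT n (t - 1)"
proof -
  let ?c = "b' @ [q - int r - 1..q - 2]"
  note bS = SST_D[OF SpT_D(1)[OF b]]
  have srt: "sorted_wrt (<) b'" using bS(1) split(1) by (simp add: sorted_wrt_append)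
  have "q \<in> set b" by (subst split(1)) simp
  then have q2n: "q \<le> 2 * int n" using bS(2) by auto
  have "sorted_wrt (<) ?c" using srt low by (fastforce simp: sorted_wrt_append)
  moreover have "set ?c \<subseteq> {1..2 * int n}" using low q q2n by force
  moreover have len: "length ?c = t - 1" using split(2) r by simp
  moreover have "entry ?c i \<ge> 2 * int i - 1" if i: "i \<in> {1..t - 1}" for i
  proof -
    have sym: "entry b j \<ge> 2 * int j - 1" if "j \<in> {1..t}" for j
      using SpT_D(2)[OF b] that bS(3) unfolding symplectic_def by blast
    obtain j where j: "i = Suc j" using i by (cases i) auto
    show ?thesis
    proof (cases "j < length b'")
      case True
      then have "entry ?c i = entry b i" by (subst split(1)) (simp add: j entry_def nth_append)
      moreover have "i \<in> {1..t}" using i by auto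
      ultimately show ?thesis using sym[of i] by simp
    next
      case False
      define k where "k = j - length b'"
      have k: "j = length b' + k" "k < r" using False i j split(2) r by (simp_all add: k_def)
      have "entry ?c i = q - int r - 1 + int k"
        using k by (simp add: j entry_def nth_append)
      moreover have "entry b (Suc i) = q - int r + int (Suc k)"
        using k by (subst split(1)) (simp add: j entry_def nth_append)
      ultimately have "entry ?c i = entry b (Suc i) - 2" by simp
      moreover have "Suc i \<in> {1..t}" using i by auto
      ultimately show ?thesis using sym[of "Suc i"] by simp
    qed
  qed
  ultimately show ?thesis unfolding SpT_def SST_def symplectic_def by simp
qed

text \<open>By the comparison of the two runs, the columns \<open>abar\<close> and \<open>a\<close> share a lower part \<open>L\<close>, and above it they
are the intervals from \<open>q - r - 1\<close> to \<open>q - 2 + s\<close> and from \<open>q - r\<close> to \<open>q + s\<close>.\<close>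
lemma red_inv_interval:
  assumes b: "b \<in> SpT n t" and t: "t \<in> red_lengths n l" "2 \<le> t" and l: "l \<le> 2 * n"
    and fixed: "has_fixed_interval_suffix b"
  shows "\<exists>r::nat. 1 \<le> r \<and> r < t \<and>
              (let q = entry b t; a = red_inv n l b;
                   b' = take (t - r - 1) b;
                   c = b' @ [q - int r - 1..q - 2];
                   abar = red_inv n (l - 1) c in
                 even q \<and>
                 entry b (t - r - 1) < q - int r - 1 \<and>
                 q - int r - 1 < entry b (t - r) \<and>
                 entry b (t - r) = q - int r \<and>
                 disj_union_of (set b) [set b', {q - int r..q}] \<and>
                 c \<in> SpT n (t - 1) \<and>
                 disj_union_of (set c) [set b - {q, parity_inv q}, {q - int r - 1}] \<and>
                 disj_union_of (set c) [set b', {q - int r - 1..q - 2}] \<and>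
                 abar \<in> SST n (l - 1) \<and>
                 (\<exists>s::int. 0 \<le> s \<and> even s \<and>
                    int (card (set abar \<inter> {1..q - int r - 2})) + int r + s = int l - 1 \<and>
                    disj_union_of (set abar)
                      [set abar \<inter> {1..q - int r - 2}, {q - int r - 1..q - 2 + s}] \<and>
                    disj_union_of (set a)
                      [set abar - {q - int r - 1}, {q - 2 + s + 1..q - 2 + s + 2}]))"
proof -
  obtain r where r: "1 \<le> r" "r < t" "even (entry b t)"
    "b = take (t - r - 1) b @ [entry b t - int r..entry b t]"
    "set (take (t - r - 1) b) \<subseteq> {1..entry b t - int r - 2}" "2 \<le> entry b t - int r"
    using maximal_run[OF b t(2) fixed] .
  define q where "q = entry b t"
  define b' where "b' = take (t - r - 1) b"
  define c where "c = b' @ [q - int r - 1..q - 2]"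
  define abar where "abar = red_inv n (l - 1) c"
  define a where "a = red_inv n l b"
  define m where "m = (l - t) div 2"
  note bS = SST_D[OF SpT_D(1)[OF b]]
  have q: "even q" "2 \<le> q - int r" and split: "b = b' @ [q - int r..q]"
    and low: "set b' \<subseteq> {1..q - int r - 2}"
    using r(3-6) by (simp_all add: q_def b'_def)
  have len: "length b' = t - r - 1" using bS(3) by (simp add: b'_def)
  have c: "c \<in> SpT n (t - 1)"
    unfolding c_def using SpT_shift_run[OF b r(1,2) split len low q(2)] .
  have t1: "1 \<le> t" and l1: "l - 1 \<le> 2 * n" using t(2) l by simp_all
  note lengths = red_lengths_pred[OF t(1) t1 l]
  have setb: "set b = set b' \<union> {q - int r..q}" by (subst split) simp
  have setc: "set c = set b' \<union> {q - int r - 1..q - 2}" by (simp add: c_def)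
  define K where "K = nat (q div 2)"
  have K: "q = 2 * int K" using q r(1) by (simp add: K_def)
  then have "1 \<le> K" using q(2) by simp
  then obtain N where N: "K = Suc N" by (cases K) auto
  have r1: "1 \<le> int r" using r(1) by simp
  obtain A d where A: "\<And>x. x \<in> pairs A \<Longrightarrow> 1 \<le> x \<and> x \<le> q - int r - 2"
    "free_pairs m (set b' \<union> {q - int r..q}) = A \<union> {Suc K..K + d}"
    "free_pairs m (set b' \<union> {q - int r - 1..q - 2}) = A \<union> {K..<K + d}"
    using free_pairs_shift_run[OF low K r1 q(2)] by metis
  define s where "s = 2 * int d"
  define L where "L = set b' \<union> pairs A"
  have L: "L \<subseteq> {1..q - int r - 2}" using low A(1) by (auto simp: L_def)
  have "{K..<K + d} = {Suc N..N + d}" using N by auto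
  then have "pairs {K..<K + d} = {q - 1..q - 2 + s}"
    using pairs_atLeastAtMost[of N d] K N by (simp add: s_def)
  then have "set abar = L \<union> ({q - int r - 1..q - 2} \<union> {q - 1..q - 2 + s})"
    unfolding abar_def red_inv_SpT(2)[OF c lengths(1) l1] lengths(2) m_def[symmetric] setc A(3)
    by (simp add: pairs_Un L_def Un_ac)
  moreover have "{q - int r - 1..q - 2} \<union> {q - 1..q - 2 + s} = {q - int r - 1..q - 2 + s}"
    using r1 by (auto simp: s_def)
  ultimately have set_abar: "set abar = L \<union> {q - int r - 1..q - 2 + s}" by simp
  have "pairs {Suc K..K + d} = {q + 1..q + s}"
    using pairs_atLeastAtMost[of K d] K by (simp add: s_def)
  then have "set a = L \<union> ({q - int r..q} \<union> {q + 1..q + s})"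
    unfolding a_def red_inv_SpT(2)[OF b t(1) l] m_def[symmetric] unfolding setb A(2)
    by (simp add: pairs_Un L_def Un_ac)
  moreover have "{q - int r..q} \<union> {q + 1..q + s} = {q - int r..q + s}"
    by (auto simp: s_def)
  ultimately have set_a: "set a = L \<union> {q - int r..q + s}" by simp
  have abar: "abar \<in> SST n (l - 1)"
    unfolding abar_def by (rule red_inv_SpT(1)[OF c lengths(1) l1])
  have meet: "set abar \<inter> {1..q - int r - 2} = L" unfolding set_abar using L by auto
  have s0: "0 \<le> s" "even s" by (simp_all add: s_def)
  have gap: "L \<inter> {q - int r - 1..q + s} = {}" using L by auto
  have disj_abar: "disj_union_of (set abar) [L, {q - int r - 1..q - 2 + s}]"
    unfolding disj_union_of_2 set_abar using gap by auto
  have card: "int (card L) + int r + s = int l - 1"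
  proof -
    have fin: "finite L" using L finite_subset by blast
    have "card (set abar) = card L + card {q - int r - 1..q - 2 + s}"
      unfolding set_abar using gap fin by (intro card_Un_disjoint) auto
    moreover have "card (set abar) = l - 1" by (rule SST_D(4)[OF abar])
    moreover have "1 \<le> l" using t t1 by (simp add: red_lengths_def)
    ultimately show ?thesis using s0 by simp
  qed
  have disj_a: "disj_union_of (set a) [set abar - {q - int r - 1}, {q - 2 + s + 1..q - 2 + s + 2}]"
    unfolding disj_union_of_2
  proof
    have "q - int r - 1 \<notin> L" using L by auto
    moreover have "{q - int r..q + s} =
        ({q - int r - 1..q - 2 + s} - {q - int r - 1}) \<union> {q - 2 + s + 1..q - 2 + s + 2}"
      using s0 r1 by auto
    ultimately show "set a = (set abar - {q - int r - 1}) \<union> {q - 2 + s + 1..q - 2 + s + 2}"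
      unfolding set_a set_abar by blast
    show "(set abar - {q - int r - 1}) \<inter> {q - 2 + s + 1..q - 2 + s + 2} = {}"
      unfolding set_abar using L s0 r1 by auto
  qed
  have entry_run: "entry b (t - r) = q - int r"
  proof -
    have "t - r = Suc (length b')" using len r(2) by simp
    then show ?thesis by (subst split) (simp add: entry_def nth_append)
  qed
  have entry_below: "entry b (t - r - 1) < q - int r - 1"
  proof (cases "t - r - 1 = 0")
    case True
    then show ?thesis using q(2) by (simp add: entry_def)
  next
    case False
    then have "entry b (length b') = b' ! (length b' - 1)"
      unfolding len[symmetric] by (subst split) (simp add: entry_def nth_append)
    also have "\<dots> \<in> set b'" using False len by simp
    finally show ?thesis using low len by auto
  qed
  have disj_b: "disj_union_of (set b) [set b', {q - int r..q}]"
    unfolding disj_union_of_2 setb using low by auto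
  have disj_c: "disj_union_of (set c) [set b', {q - int r - 1..q - 2}]"
    unfolding disj_union_of_2 setc using low by auto
  have par: "parity_inv q = q - 1" using q(1) by (simp add: parity_inv_def)
  have disj_c': "disj_union_of (set c) [set b - {q, parity_inv q}, {q - int r - 1}]"
    unfolding disj_union_of_2 setb setc par
  proof
    have "q \<notin> set b'" "q - 1 \<notin> set b'" using low by auto
    moreover have "{q - int r - 1..q - 2} = ({q - int r..q} - {q, q - 1}) \<union> {q - int r - 1}"
      using r1 by auto
    ultimately show "set b' \<union> {q - int r - 1..q - 2} =
        (set b' \<union> {q - int r..q} - {q, q - 1}) \<union> {q - int r - 1}" by blast
    show "(set b' \<union> {q - int r..q} - {q, q - 1}) \<inter> {q - int r - 1} = {}" using low by auto
  qed
  show ?thesis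
    apply (rule exI[of _ r])
    unfolding Let_def q_def[symmetric] b'_def[symmetric]
    unfolding c_def[symmetric] unfolding abar_def[symmetric] a_def[symmetric] meet
    using r(1,2) q(1) entry_below entry_run disj_b c disj_c' disj_c abar s0 card disj_abar disj_a
    by auto
qed

lemma SpT_1: "SpT n 1 = SST n 1"
proof
  show "SST n 1 \<subseteq> SpT n 1"
  proof
    fix a assume a: "a \<in> SST n 1"
    then obtain x where "a = [x]" using SST_D(3)[OF a] by (cases a) auto
    then show "a \<in> SpT n 1" using a SST_D(2)[OF a] by (auto simp: SpT_def symplectic_def entry_def)
  qed
qed (auto simp: SpT_def)

lemma SpT_2: "SpT n 2 = SST n 2 - {[1, 2]}"
proof -
  have "symplectic a \<longleftrightarrow> a \<noteq> [1, 2]" if a: "a \<in> SST n 2" for a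
  proof -
    obtain x y where xy: "a = [x, y]"
      using SST_D(3)[OF a] by (auto simp: numeral_2_eq_2 length_Suc_conv)
    have "1 \<le> x" "x < y" using SST_D(1,2)[OF a] by (auto simp: xy)
    moreover have "{1..length a} = {1, 2}" by (auto simp: xy)
    ultimately show ?thesis by (auto simp: symplectic_def entry_def xy)
  qed
  then show ?thesis unfolding SpT_def by blast
qed

theorem theorem3:
  fixes n l :: nat
  assumes "n \<ge> 1" and "l \<le> 2 * n"
  shows
    "red_inv n l \<in> red_target n l \<rightarrow> SST n l \<and>

     (l = 0 \<longrightarrow> red_lengths n l = {0} \<and> SpT n 0 = SST n 0 \<and> SST n 0 = {[]} \<and>
        (\<forall>b\<in>SpT n 0. red_inv n l b = b)) \<and>
     (l = 1 \<longrightarrow> red_lengths n l = {1} \<and> SpT n 1 = SST n 1 \<and>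
        (\<forall>b\<in>SpT n 1. red_inv n l b = b)) \<and>

     (l = 2 \<longrightarrow> SpT n 2 = SST n 2 - {[1, 2]} \<and>
        (\<forall>t\<in>red_lengths n l. \<forall>b\<in>SpT n t.
           (t = 0 \<and> b = [] \<and> red_inv n l b = [1, 2]) \<or>
           (t = 2 \<and> red_inv n l b = b))) \<and>

     (l \<ge> 3 \<longrightarrow>
        (\<forall>t\<in>red_lengths n l. \<forall>b\<in>SpT n t.
           (t = 0 \<and> even l \<longrightarrow> b = [] \<and> red_inv n l b = [1..int l]) \<and>
           (t = 1 \<and> odd l \<longrightarrow>
              (let q = entry b 1; a = red_inv n l b; ahat = red_inv n (l - 1) [] in
                 b = [q] \<and>
                 ahat = [1..int l - 1] \<and>
                 by_cases
                  [(set ahat \<subseteq> {1..q - 1},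
                      disj_union_of (set a) [set ahat, {q}]),
                   (odd q \<and> q \<in> set ahat,
                      disj_union_of (set a) [set ahat - {q + 1}, {int l..int l + 1}]),
                   (even q \<and> q \<in> set ahat,
                      disj_union_of (set a) [set ahat - {q - 1}, {int l..int l + 1}])])))) \<and>

     (l \<ge> 3 \<longrightarrow>
        (\<forall>t\<in>red_lengths n l. \<forall>b\<in>SpT n t. t \<ge> 2 \<and> \<not> has_fixed_interval_suffix b \<longrightarrow>
           (let p = entry b (t - 1); q = entry b t; a = red_inv n l b;
                ahat = red_inv n (l - 1) (take (t - 1) b) in
              ahat \<in> SST n (l - 1) \<and>
              (\<exists>s::int. 0 \<le> s \<and> even s \<and>
                 s + int (card (set ahat \<inter> {1..p})) = int l - 1 \<and>
                 by_cases
                  [(even p,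
                      disj_union_of (set ahat)
                        [set ahat \<inter> {1..p - 1}, {p}, {p + 1..p + s}]),
                   (odd p,
                      disj_union_of (set ahat)
                        [set ahat \<inter> {1..p - 1}, {p}, {p + 2..p + 1 + s}])] \<and>
                 by_cases
                  [(set ahat \<subseteq> {1..q - 1} \<and> odd q,
                      disj_union_of (set a) [set ahat, {q}]),
                   (q \<in> set ahat \<and> even p \<and> odd q,
                      disj_union_of (set a)
                        [set ahat - {parity_inv q}, {p + 1 + s..p + 2 + s}]),
                   (q \<in> set ahat \<and> odd p \<and> odd q,
                      disj_union_of (set a)
                        [set ahat - {parity_inv q}, {p + 2 + s..p + 3 + s}]),
                   (set ahat \<subseteq> {1..q - 2} \<and> p < q - 1 \<and> even q,
                      disj_union_of (set a) [set ahat, {q}]),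
                   (parity_inv q \<in> set ahat \<and> p < q - 1 \<and> even p \<and> even q,
                      disj_union_of (set a)
                        [set ahat - {parity_inv q}, {p + s + 1..p + s + 2}]),
                   (parity_inv q \<in> set ahat \<and> p < q - 1 \<and> odd p \<and> even q,
                      disj_union_of (set a)
                        [set ahat - {parity_inv q}, {p + s + 2..p + s + 3}])])))) \<and>

     (l \<ge> 3 \<longrightarrow>
        (\<forall>t\<in>red_lengths n l. \<forall>b\<in>SpT n t. t \<ge> 2 \<and> has_fixed_interval_suffix b \<longrightarrow>
           (\<exists>r::nat. 1 \<le> r \<and> r < t \<and>
              (let q = entry b t; a = red_inv n l b;
                   b' = take (t - r - 1) b;
                   c = b' @ [q - int r - 1..q - 2];
                   abar = red_inv n (l - 1) c in
                 even q \<and>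
                 entry b (t - r - 1) < q - int r - 1 \<and>
                 q - int r - 1 < entry b (t - r) \<and>
                 entry b (t - r) = q - int r \<and>
                 disj_union_of (set b) [set b', {q - int r..q}] \<and>
                 c \<in> SpT n (t - 1) \<and>
                 disj_union_of (set c) [set b - {q, parity_inv q}, {q - int r - 1}] \<and>
                 disj_union_of (set c) [set b', {q - int r - 1..q - 2}] \<and>
                 abar \<in> SST n (l - 1) \<and>
                 (\<exists>s::int. 0 \<le> s \<and> even s \<and>
                    int (card (set abar \<inter> {1..q - int r - 2})) + int r + s = int l - 1 \<and>
                    disj_union_of (set abar)
                      [set abar \<inter> {1..q - int r - 2}, {q - int r - 1..q - 2 + s}] \<and>
                    disj_union_of (set a)
                      [set abar - {q - int r - 1}, {q - 2 + s + 1..q - 2 + s + 2}])))))"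
  \<comment> \<open>The goals are, in order: the codomain, lengths 0 to 2, and longer columns by the shape of \<open>b\<close>.\<close>
proof (intro conjI impI ballI, goal_cases)
  case 1
  show ?case using red_inv_SpT(1)[OF _ _ assms(2)] by (auto simp: red_target_def)
next
  case 2
  then show ?case by (auto simp: red_lengths_def)
next
  case 3
  then show ?case by (simp add: SpT_0)
next
  case 4
  then show ?case by (simp add: SpT_0)
next
  case (5 b)
  then have "0 \<in> red_lengths n l" by (simp add: red_lengths_def)
  then show ?case using red_inv_full_length[of b n l] 5 by simp
next
  case 6
  have "even (1 - t) \<longleftrightarrow> t = 1" if "t \<le> 1" for t :: nat using that by (cases t) auto
  then show ?case using 6 assms(1) by (auto simp: red_lengths_def)
next
  case 7
  show ?case by (rule SpT_1)
next
  case (8 b)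
  then have "1 \<in> red_lengths n l" using assms(1) by (simp add: red_lengths_def)
  then show ?case using red_inv_full_length[of b n l] 8 assms(2) by simp
next
  case 9
  show ?case by (rule SpT_2)
next
  case (10 t b)
  then have "t \<le> 2" "even (2 - t)" by (auto simp: red_lengths_def)
  then consider "t = 0" | "t = 2" by (cases "t = 1") force+
  then show ?case
  proof cases
    case 1
    have "[1..2::int] = [1, 2]" by (simp add: upto_rec1)
    then show ?thesis using 1 10 assms(2) red_inv_Nil[of n l] by (simp add: SpT_0)
  next
    case 2
    then show ?thesis using 10 assms(2) red_inv_full_length[of b n l] by simp
  qed
next
  case (11 t b)
  then show ?case by (simp add: SpT_0)
next
  case (12 t b)
  then show ?case using red_inv_Nil[OF _ assms(2)] by (simp add: SpT_0)
next
  case (13 t b)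
  then show ?case using red_inv_single[of b n l] assms(2) by blast
next
  case (14 t b)
  then show ?case by (intro red_inv_no_interval) (use assms(2) in simp_all)
next
  case (15 t b)
  then show ?case by (intro red_inv_interval) (use assms(2) in simp_all)
qed

end
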